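(* Let $\varsigma,\sigma>0$ and $V(r)=4\varsigma\frac{\sigma^6}{r^6}-4\varsigma\frac{\sigma^{12}}{r^{12}}$ for $r>0$ (Lennard-Jones potential). Let $w_0$, $\Lambda$, $T$ and $\Theta$ be as defined in the context, and let $\mathcal{D}=\partial_HT\cdot\partial_L\Theta-\partial_LT\cdot\partial_H\Theta$ on $\Lambda$. Then, for every admissible $L>0$ sufficiently small, $$\lim_{H\to(-w_0(L))^+}\mathcal{D}(H,L)>0 .$$ Consequently, for every admissible $L>0$ small enough there exists $\tilde H(L)>-w_0(L)$ such that $\mathcal{D}(H,L)>0$ for every $H\in(-w_0(L),\tilde H(L))$.
   Context: For $L>0$ let $W(r;L)=\frac{L^2}{2r^2}-4\varsigma\frac{\sigma^6}{r^6}+4\varsigma\frac{\sigma^{12}}{r^{12}}$, $r>0$. A value $L>0$ is called admissible if $L^2<\left(\frac15\right)^{2/3}\frac{72}{5}\varsigma\sigma^2$. For admissible $L$, $W'(\cdot;L)$ (derivative in $r$) has exactly two positive zeros $r_0(L)<r_2(L)$, with $W'(\cdot;L)<0$ on $(0,r_0(L))\cup(r_2(L),+\infty)$ and $W'(\cdot;L)>0$ on $(r_0(L),r_2(L))$. Put $w_0(L)=-W(r_0(L);L)$ and $$\Lambda=\{(H,L)\in\mathbb{R}^2:\ L>0\text{ admissible},\ -w_0(L)<H<W(r_2(L);L)\}.$$ For $(H,L)\in\Lambda$ let $r_-(H,L)\in(0,r_0(L))$ and $r_+(H,L)\in(r_0(L),r_2(L))$ be the solutions of $W(r;L)=H$ in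 these intervals, and $$T(H,L)=\sqrt2\int_{r_-(H,L)}^{r_+(H,L)}\frac{dr}{\sqrt{H-W(r;L)}},\qquad\Theta(H,L)=\sqrt2\,L\int_{r_-(H,L)}^{r_+(H,L)}\frac{dr}{r^2\sqrt{H-W(r;L)}}.$$ These are $\mathcal{C}^1$ functions on $\Lambda$. *)

theory Defs
  imports "HOL-Analysis.Analysis"
begin

definition V :: "real \<Rightarrow> real \<Rightarrow> real \<Rightarrow> real" where
  "V \<epsilon> \<sigma> r = 4 * \<epsilon> * (\<sigma> ^ 6 / r ^ 6) - 4 * \<epsilon> * (\<sigma> ^ 12 / r ^ 12)"

definition W :: "real \<Rightarrow> real \<Rightarrow> real \<Rightarrow> real \<Rightarrow> real" where
  "W \<epsilon> \<sigma> L r = L\<^sup>2 / (2 * r\<^sup>2) - V \<epsilon> \<sigma> r"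

definition admissible :: "real \<Rightarrow> real \<Rightarrow> real \<Rightarrow> bool" where
  "admissible \<epsilon> \<sigma> L \<longleftrightarrow> L > 0 \<and> L\<^sup>2 < (1 / 5) powr (2 / 3) * (72 / 5) * \<epsilon> * \<sigma>\<^sup>2"

definition crit :: "real \<Rightarrow> real \<Rightarrow> real \<Rightarrow> real set" where
  "crit \<epsilon> \<sigma> L = {r. r > 0 \<and> deriv (W \<epsilon> \<sigma> L) r = 0}"

text \<open>For admissible \<open>L\<close> the set \<open>crit \<epsilon> \<sigma> L\<close> has exactly two elements.\<close>

definition r0 :: "real \<Rightarrow> real \<Rightarrow> real \<Rightarrow> real" where
  "r0 \<epsilon> \<sigma> L = Min (crit \<epsilon> \<sigma> L)"

definition r2 :: "real \<Rightarrow> real \<Rightarrow> real \<Rightarrow> real" where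
  "r2 \<epsilon> \<sigma> L = Max (crit \<epsilon> \<sigma> L)"

definition w0 :: "real \<Rightarrow> real \<Rightarrow> real \<Rightarrow> real" where
  "w0 \<epsilon> \<sigma> L = - W \<epsilon> \<sigma> L (r0 \<epsilon> \<sigma> L)"

definition Lam :: "real \<Rightarrow> real \<Rightarrow> (real \<times> real) set" where
  "Lam \<epsilon> \<sigma> = {(H, L). admissible \<epsilon> \<sigma> L \<and>
      - w0 \<epsilon> \<sigma> L < H \<and> H < W \<epsilon> \<sigma> L (r2 \<epsilon> \<sigma> L)}"

definition r_minus :: "real \<Rightarrow> real \<Rightarrow> real \<Rightarrow> real \<Rightarrow> real" where
  "r_minus \<epsilon> \<sigma> H L = (THE r. 0 < r \<and> r < r0 \<epsilon> \<sigma> L \<and> W \<epsilon> \<sigma> L r = H)"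

definition r_plus :: "real \<Rightarrow> real \<Rightarrow> real \<Rightarrow> real \<Rightarrow> real" where
  "r_plus \<epsilon> \<sigma> H L = (THE r. r0 \<epsilon> \<sigma> L < r \<and> r < r2 \<epsilon> \<sigma> L \<and> W \<epsilon> \<sigma> L r = H)"

text \<open>The integrands are positive and unbounded at both end points; the improper
  integrals are rendered as Lebesgue integrals over the open interval.\<close>

definition T :: "real \<Rightarrow> real \<Rightarrow> real \<Rightarrow> real \<Rightarrow> real" where
  "T \<epsilon> \<sigma> H L = sqrt 2 *
     (LBINT r:{r_minus \<epsilon> \<sigma> H L<..<r_plus \<epsilon> \<sigma> H L}. 1 / sqrt (H - W \<epsilon> \<sigma> L r))"

definition \<Theta> :: "real \<Rightarrow> real \<Rightarrow> real \<Rightarrow> real \<Rightarrow> real" where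
  "\<Theta> \<epsilon> \<sigma> H L = sqrt 2 * L *
     (LBINT r:{r_minus \<epsilon> \<sigma> H L<..<r_plus \<epsilon> \<sigma> H L}. 1 / (r\<^sup>2 * sqrt (H - W \<epsilon> \<sigma> L r)))"

text \<open>\<open>\<D>\<close> is meaningful only for \<open>(H, L) \<in> Lam \<epsilon> \<sigma>\<close>, an open set on which \<open>T\<close> and \<open>\<Theta>\<close>
  are continuously differentiable.\<close>

definition \<D> :: "real \<Rightarrow> real \<Rightarrow> real \<Rightarrow> real \<Rightarrow> real" where
  "\<D> \<epsilon> \<sigma> H L =
     deriv (\<lambda>h. T \<epsilon> \<sigma> h L) H * deriv (\<lambda>l. \<Theta> \<epsilon> \<sigma> H l) L
   - deriv (\<lambda>l. T \<epsilon> \<sigma> H l) L * deriv (\<lambda>h. \<Theta> \<epsilon> \<sigma> h L) H"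

end

theory Submission
  imports Defs
begin

text \<open>In the variable \<open>u = \<sigma>\<^sup>2 / r\<^sup>2\<close> the effective potential is a polynomial, so the potential gap
  factors as \<open>(s - v\<^sup>2) q(m, s, v)\<close> with \<open>u = m + v\<close> and turning points \<open>m \<plusminus> sqrt s\<close>. The
  substitution \<open>v = sqrt s cos t\<close> then turns \<open>T\<close> and \<open>\<Theta>\<close> into proper integrals over \<open>[0, \<pi>]\<close>, which are
  continuously differentiable in \<open>(m, s)\<close> up to \<open>s = 0\<close>. The map from \<open>(m, s)\<close> to angular
  momentum level and energy is polynomial and locally invertible near the minimum of the potential
  with \<open>L = 0\<close>, that is at \<open>(m, s) = (2\<^sup>-\<^sup>1\<^sup>/\<^sup>3, 0)\<close>. By the chain rule \<open>\<D>\<close> is a continuous function of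
  \<open>(m, s)\<close>, and at that point it is a positive multiple of \<open>\<partial>T/\<partial>H\<close> for \<open>L = 0\<close>,
  which is positive by an explicit computation. Continuity gives positivity for small \<open>L\<close> and
  \<open>H\<close> near the minimum.\<close>

section \<open>Critical points and turning points\<close>

text \<open>With u = \<sigma>^2 / r^2, the function \<open>W\<close> is 4 \<epsilon> times
  \<open>red_pot\<close> at level \<open>red_level\<close>; the critical radii then solve
  \<open>crit_level u = \<alpha>\<close>.\<close>

definition crit_level :: "real \<Rightarrow> real" where
  "crit_level u = 3 * u^2 - 6 * u^5"

definition red_pot :: "real \<Rightarrow> real \<Rightarrow> real" where
  "red_pot \<alpha> u = \<alpha> * u - u^3 + u^6"

definition red_level :: "real \<Rightarrow> real \<Rightarrow> real \<Rightarrow> real" where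
  "red_level \<epsilon> \<sigma> L = L^2 / (8 * \<epsilon> * \<sigma>^2)"

lemma red_pot_deriv:
  "(red_pot \<alpha> has_real_derivative \<alpha> - crit_level u) (at u)"
  unfolding red_pot_def[abs_def] crit_level_def
  by (auto intro!: derivative_eq_intros)

lemma W_red_pot:
  assumes "\<epsilon> > 0" "\<sigma> > 0"
  shows "W \<epsilon> \<sigma> L r = 4 * \<epsilon> * red_pot (red_level \<epsilon> \<sigma> L) (\<sigma>^2 / r^2)"
  using assms unfolding W_def V_def red_pot_def red_level_def
  by (simp add: field_simps power_divide flip: power_mult)

lemma W_at_sqrt:
  assumes "\<epsilon> > 0" "\<sigma> > 0" "u > 0"
  shows "W \<epsilon> \<sigma> L (\<sigma> / sqrt u) = 4 * \<epsilon> * red_pot (red_level \<epsilon> \<sigma> L) u"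
  using assms by (simp add: W_red_pot power_divide)

lemma deriv_W:
  assumes "\<epsilon> > 0" "\<sigma> > 0" "r > 0"
  shows "deriv (W \<epsilon> \<sigma> L) r =
    8 * \<epsilon> * (\<sigma>^2 / r^2) / r * (crit_level (\<sigma>^2 / r^2) - red_level \<epsilon> \<sigma> L)"
proof -
  have "((\<lambda>r. 4 * \<epsilon> * red_pot (red_level \<epsilon> \<sigma> L) (\<sigma>^2 / r^2)) has_real_derivative
      4 * \<epsilon> * ((red_level \<epsilon> \<sigma> L - crit_level (\<sigma>^2 / r^2)) * (- 2 * \<sigma>^2 / r^3))) (at r)"
    using assms
    by (intro DERIV_cmult DERIV_chain2[OF red_pot_deriv])
      (auto intro!: derivative_eq_intros simp: divide_simps power_numeral_reduce)
  moreover have "W \<epsilon> \<sigma> L = (\<lambda>r. 4 * \<epsilon> * red_pot (red_level \<epsilon> \<sigma> L) (\<sigma>^2 / r^2))"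
    using W_red_pot[OF assms(1,2)] by auto
  ultimately show ?thesis
    using assms by (simp add: DERIV_imp_deriv field_simps power_numeral_reduce)
qed

text \<open>The derivative 6 u (1 - 5 u^3) changes sign at the cube root of 1/5, about 0.585. The
  rational brackets 1/2 and 3/5 around it keep that root out of the estimates.\<close>

lemma crit_level_strict_mono:
  assumes "0 \<le> u" "u < v" "v \<le> 1/2"
  shows "crit_level u < crit_level v"
proof (rule DERIV_pos_imp_increasing_open[OF assms(2)])
  fix x assume x: "u < x" "x < v"
  have "x^3 < (1/2)^3" using x assms by (intro power_strict_mono) auto
  then have "0 < 6 * x * (1 - 5 * x^3)" using x assms by (auto simp: power_divide)
  moreover have "(crit_level has_real_derivative 6 * x * (1 - 5 * x^3)) (at x)"
    unfolding crit_level_def[abs_def]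
    by (auto intro!: derivative_eq_intros simp: algebra_simps power_numeral_reduce)
  ultimately show "\<exists>y. (crit_level has_real_derivative y) (at x) \<and> 0 < y" by blast
next
  show "continuous_on {u..v} crit_level"
    unfolding crit_level_def[abs_def] by (intro continuous_intros)
qed

lemma crit_level_strict_antimono:
  assumes "3/5 \<le> u" "u < v"
  shows "crit_level v < crit_level u"
proof (rule DERIV_neg_imp_decreasing_open[OF assms(2)])
  fix x assume x: "u < x" "x < v"
  have "(3/5)^3 < x^3" using x assms by (intro power_strict_mono) auto
  then have "6 * x * (1 - 5 * x^3) < 0" using x assms by (intro mult_pos_neg) (auto simp: power_divide)
  moreover have "(crit_level has_real_derivative 6 * x * (1 - 5 * x^3)) (at x)"
    unfolding crit_level_def[abs_def]
    by (auto intro!: derivative_eq_intros simp: algebra_simps power_numeral_reduce)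
  ultimately show "\<exists>y. (crit_level has_real_derivative y) (at x) \<and> y < 0" by blast
next
  show "continuous_on {u..v} crit_level"
    unfolding crit_level_def[abs_def] by (intro continuous_intros)
qed

text \<open>The value 2/5 is a rational number below the maximum (9/5) (1/5)^(2/3) of
  \<open>crit_level\<close>, which is the level at which admissibility ends. Working below 2/5
  suffices for small L.\<close>

lemma crit_level_middle:
  assumes "1/2 \<le> u" "u \<le> 3/5"
  shows "crit_level u > 2/5"
proof -
  have "(1/2)^2 \<le> u^2" "u^3 \<le> (3/5)^3" using assms by (intro power_mono; simp)+
  then have "1/4 * (3 - 6 * (27/125)) \<le> u^2 * (3 - 6 * u^3)"
    by (intro mult_mono) (auto simp: power_divide)
  then show ?thesis unfolding crit_level_def by (simp add: algebra_simps power_numeral_reduce)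
qed

text \<open>\<open>min_root\<close> yields the minimum \<open>r0\<close> of the potential: the larger root in \<open>u\<close> is the smaller
  one in \<open>r\<close>.\<close>

definition min_root :: "real \<Rightarrow> real" where
  "min_root \<alpha> = (THE u. 3/5 \<le> u \<and> crit_level u = \<alpha>)"

lemma min_root_eqI:
  assumes "3/5 \<le> u" "crit_level u = \<alpha>"
  shows "min_root \<alpha> = u"
  unfolding min_root_def
proof (rule the_equality)
  fix v assume "3/5 \<le> v \<and> crit_level v = \<alpha>"
  then show "v = u"
    using assms crit_level_strict_antimono[of u v] crit_level_strict_antimono[of v u]
    by (cases u v rule: linorder_cases) auto
qed (use assms in auto)

text \<open>The intermediate value theorem on [0, 1/2] and on [3/5, 1] gives one root on each side
  of the maximum; monotonicity on the two sides and the bound in between give the sign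
  pattern.\<close>

lemma crit_level_roots:
  assumes "0 < \<alpha>" "\<alpha> < 2/5"
  obtains w where "0 < w" "w < 1/2" "crit_level w = \<alpha>"
    "3/5 < min_root \<alpha>" "crit_level (min_root \<alpha>) = \<alpha>"
    "\<And>u. w < u \<Longrightarrow> u < min_root \<alpha> \<Longrightarrow> \<alpha> < crit_level u"
    "\<And>u. min_root \<alpha> < u \<Longrightarrow> crit_level u < \<alpha>"
    "\<And>u. 0 < u \<Longrightarrow> u < w \<Longrightarrow> crit_level u < \<alpha>"
proof -
  have cont: "continuous_on A crit_level" for A
    unfolding crit_level_def[abs_def] by (intro continuous_intros)
  have "\<exists>w\<ge>0. w \<le> 1/2 \<and> crit_level w = \<alpha>"
    using crit_level_middle[of "1/2"] assms
    by (intro IVT'[OF _ _ _ cont]) (auto simp: crit_level_def)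
  then obtain w where w: "0 \<le> w" "w \<le> 1/2" "crit_level w = \<alpha>" by blast
  have "w \<noteq> 0" using w assms by (auto simp: crit_level_def)
  moreover have "w \<noteq> 1/2" using w(3) assms crit_level_middle[of w] by force
  ultimately have w': "0 < w" "w < 1/2" using w by auto
  have "\<exists>v\<ge>3/5. v \<le> 1 \<and> crit_level v = \<alpha>"
    using crit_level_middle[of "3/5"] assms
    by (intro IVT2'[OF _ _ _ cont]) (auto simp: crit_level_def)
  then obtain v where v: "3/5 \<le> v" "crit_level v = \<alpha>" by blast
  have v': "min_root \<alpha> = v" using min_root_eqI v by blast
  have v'': "3/5 < v" using v assms crit_level_middle[of v] by force
  show ?thesis
  proof (rule that[of w])
    show "\<alpha> < crit_level u" if "w < u" "u < min_root \<alpha>" for u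
    proof -
      consider "u \<le> 1/2" | "1/2 \<le> u" "u \<le> 3/5" | "3/5 \<le> u" by linarith
      then show ?thesis
        using crit_level_strict_mono[of w u] crit_level_middle[of u]
          crit_level_strict_antimono[of u v] that w' w v v' assms by cases auto
    qed
    show "crit_level u < \<alpha>" if "min_root \<alpha> < u" for u
      using crit_level_strict_antimono[of v u] v v' that by auto
    show "crit_level u < \<alpha>" if "0 < u" "u < w" for u
      using crit_level_strict_mono[of u w] w w' that by auto
  qed (use w w' v v' v'' in auto)
qed

lemma sqrt_param:
  fixes \<sigma> r :: real
  assumes "\<sigma> > 0" "r > 0"
  shows "r = \<sigma> / sqrt (\<sigma>^2 / r^2)"
  using assms by (simp add: real_sqrt_divide)

text \<open>By \<open>deriv_W\<close> and the sign pattern of \<open>crit_level\<close>, exactly two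
  radii are critical. As u decreases in r, the smaller radius \<open>r0\<close> belongs to the
  larger root.\<close>

lemma crit_eq:
  assumes "\<epsilon> > 0" "\<sigma> > 0" "0 < red_level \<epsilon> \<sigma> L" "red_level \<epsilon> \<sigma> L < 2/5"
  obtains w where "0 < w" "w < 1/2"
    "\<And>u. w < u \<Longrightarrow> u < min_root (red_level \<epsilon> \<sigma> L) \<Longrightarrow> red_level \<epsilon> \<sigma> L < crit_level u"
    "\<And>u. 0 < u \<Longrightarrow> u < w \<Longrightarrow> crit_level u < red_level \<epsilon> \<sigma> L"
    "r0 \<epsilon> \<sigma> L = \<sigma> / sqrt (min_root (red_level \<epsilon> \<sigma> L))"
    "r2 \<epsilon> \<sigma> L = \<sigma> / sqrt w"
proof -
  let ?\<alpha> = "red_level \<epsilon> \<sigma> L"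
  let ?v = "min_root ?\<alpha>"
  obtain w where w: "0 < w" "w < 1/2" "crit_level w = ?\<alpha>"
    "3/5 < ?v" "crit_level ?v = ?\<alpha>"
    "\<And>u. w < u \<Longrightarrow> u < ?v \<Longrightarrow> ?\<alpha> < crit_level u"
    "\<And>u. ?v < u \<Longrightarrow> crit_level u < ?\<alpha>"
    "\<And>u. 0 < u \<Longrightarrow> u < w \<Longrightarrow> crit_level u < ?\<alpha>"
    using crit_level_roots assms by blast
  have root: "crit_level u = ?\<alpha> \<longleftrightarrow> u = w \<or> u = ?v" if "u > 0" for u
    using w(3,5) w(6)[of u] w(7)[of u] w(8)[of u] that
    by (cases u w rule: linorder_cases; cases u ?v rule: linorder_cases) auto
  have "crit \<epsilon> \<sigma> L = {r. r > 0 \<and> crit_level (\<sigma>^2 / r^2) = ?\<alpha>}"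
    unfolding crit_def using assms by (auto simp: deriv_W)
  also have "\<dots> = {r. r > 0 \<and> (\<sigma>^2 / r^2 = w \<or> \<sigma>^2 / r^2 = ?v)}"
    using root[of "\<sigma>^2 / r^2" for r] assms by (intro Collect_cong conj_cong) auto
  also have "\<dots> = {\<sigma> / sqrt ?v, \<sigma> / sqrt w}"
  proof -
    have "\<sigma>^2 / r^2 = c \<longleftrightarrow> r = \<sigma> / sqrt c" if "r > 0" "c > 0" for r c
      using sqrt_param[of \<sigma> r] assms(2) that by (auto simp: power_divide)
    then show ?thesis using w(1,4) assms(2) by auto
  qed
  finally have crit: "crit \<epsilon> \<sigma> L = {\<sigma> / sqrt ?v, \<sigma> / sqrt w}" .
  have le: "\<sigma> / sqrt ?v \<le> \<sigma> / sqrt w"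
    using w assms by (intro divide_left_mono) auto
  show ?thesis
    using w le by (intro that[of w]) (auto simp: crit r0_def r2_def)
qed

text \<open>The coordinates \<open>(m, s)\<close>: the turning points in the variable \<open>u = \<sigma>\<^sup>2 / r\<^sup>2\<close> are
  \<open>m \<plusminus> sqrt s\<close>. Equality of the potential at both determines the angular momentum level
  \<open>ang m s\<close>, and \<open>en m s\<close> is the common value. Unlike \<open>(H, L)\<close>, these coordinates
  are regular at the circular orbits \<open>s = 0\<close>.\<close>

definition ang :: "real \<Rightarrow> real \<Rightarrow> real" where
  "ang m s = 3*m^2 - 6*m^5 - (20*m^3 - 1) * s - 6*m * s^2"

definition en :: "real \<Rightarrow> real \<Rightarrow> real" where
  "en m s = ang m s * m - m^3 + m^6 + (15*m^4 - 3*m) * s + 15*m^2 * s^2 + s^3"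

text \<open>Cofactor of s - v^2 in the potential gap. At s = v = 0 it is half the second derivative
  of the potential at \<open>m\<close>, hence positive at a nondegenerate minimum.\<close>

definition quo :: "real \<Rightarrow> real \<Rightarrow> real \<Rightarrow> real" where
  "quo m s v = 15*m^4 - 3*m + (20*m^3 - 1) * v + 15*m^2*(s + v^2) + 6*m * v * (s + v^2)
     + (s^2 + s * v^2 + v^4)"

text \<open>Expand the potential at m + v in powers of v. The choice of \<open>ang\<close> makes the
  odd part vanish at v^2 = s, and \<open>en\<close> is the value of the even part there, so s - v^2
  divides the difference.\<close>

lemma en_minus_red_pot: "en m s - red_pot (ang m s) (m + v) = (s - v^2) * quo m s v"
  unfolding en_def red_pot_def ang_def quo_def by algebra

lemma ang_0: "ang m 0 = crit_level m"
  by (simp add: ang_def crit_level_def)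

lemma en_0: "en m 0 = red_pot (ang m 0) m"
  using en_minus_red_pot[of m 0 0] by simp

lemma red_pot_strict_mono:
  assumes "0 < \<alpha>" "\<alpha> < 2/5" "min_root \<alpha> \<le> u" "u < v"
  shows "red_pot \<alpha> u < red_pot \<alpha> v"
proof -
  obtain w where w: "\<And>u. min_root \<alpha> < u \<Longrightarrow> crit_level u < \<alpha>"
    using crit_level_roots assms(1,2) by blast
  show ?thesis
  proof (rule DERIV_pos_imp_increasing_open[OF assms(4)])
    fix x assume "u < x" "x < v"
    then show "\<exists>y. (red_pot \<alpha> has_real_derivative y) (at x) \<and> 0 < y"
      using red_pot_deriv[of \<alpha> x] w[of x] assms by (intro exI[of _ "\<alpha> - crit_level x"]) auto
  next
    show "continuous_on {u..v} (red_pot \<alpha>)"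
      unfolding red_pot_def[abs_def] by (intro continuous_intros)
  qed
qed

lemma red_pot_strict_antimono:
  assumes "\<And>u. w < u \<Longrightarrow> u < min_root \<alpha> \<Longrightarrow> \<alpha> < crit_level u"
    and "w \<le> u" "u < v" "v \<le> min_root \<alpha>"
  shows "red_pot \<alpha> v < red_pot \<alpha> u"
proof (rule DERIV_neg_imp_decreasing_open[OF assms(3)])
  fix x assume "u < x" "x < v"
  then show "\<exists>y. (red_pot \<alpha> has_real_derivative y) (at x) \<and> y < 0"
    using red_pot_deriv[of \<alpha> x] assms(1)[of x] assms by (intro exI[of _ "\<alpha> - crit_level x"]) auto
next
  show "continuous_on {u..v} (red_pot \<alpha>)"
    unfolding red_pot_def[abs_def] by (intro continuous_intros)
qed

text \<open>The potential in u is strictly monotone on each side of \<open>min_root\<close>, so a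
  solution on a given side is unique. Passing from u to r reverses the order, hence
  \<open>r_minus\<close> goes with the plus sign.\<close>

lemma r_pm_eq:
  assumes "\<epsilon> > 0" "\<sigma> > 0" "red_level \<epsilon> \<sigma> L = ang m s" "H = 4 * \<epsilon> * en m s"
    and "0 < ang m s" "ang m s < 2/5" "s > 0" "3/5 < m - sqrt s"
  shows "r_minus \<epsilon> \<sigma> H L = \<sigma> / sqrt (m + sqrt s)"
    and "r_plus \<epsilon> \<sigma> H L = \<sigma> / sqrt (m - sqrt s)"
proof -
  let ?\<alpha> = "ang m s"
  let ?P = "red_pot ?\<alpha>"
  let ?v = "min_root ?\<alpha>"
  obtain w where w: "0 < w" "w < 1/2"
    "\<And>u. w < u \<Longrightarrow> u < ?v \<Longrightarrow> ?\<alpha> < crit_level u"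
    "r0 \<epsilon> \<sigma> L = \<sigma> / sqrt ?v" "r2 \<epsilon> \<sigma> L = \<sigma> / sqrt w"
    using crit_eq[of \<epsilon> \<sigma> L] assms by metis
  have v: "3/5 < ?v" using crit_level_roots assms(5,6) by blast
  have pot: "?P (m + sqrt s) = en m s" "?P (m - sqrt s) = en m s"
    using en_minus_red_pot[of m s "sqrt s"] en_minus_red_pot[of m s "- sqrt s"] assms by auto
  have lt: "m - sqrt s < m + sqrt s" using assms by simp
  have mono: "?P a < ?P b" if "?v \<le> a" "a < b" for a b
    using red_pot_strict_mono assms that by blast
  have anti: "?P b < ?P a" if "w \<le> a" "a < b" "b \<le> ?v" for a b
    using red_pot_strict_antimono[OF w(3)] that by blast
  \<comment> \<open>Equal values at two distinct points exclude that both lie on the same monotone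
    branch, so the points straddle the minimum.\<close>
  have up: "?v < m + sqrt s"
    using anti[of "m - sqrt s" "m + sqrt s"] pot lt assms(8) w(2) by (cases "?v < m + sqrt s") auto
  have dn: "m - sqrt s < ?v"
    using mono[of "m - sqrt s" "m + sqrt s"] pot lt by (cases "m - sqrt s < ?v") auto
  have W: "W \<epsilon> \<sigma> L (\<sigma> / sqrt u) = 4 * \<epsilon> * ?P u" if "u > 0" for u
    using W_at_sqrt[of \<epsilon> \<sigma> u L] assms that by simp
  have ord: "\<sigma> / sqrt a < \<sigma> / sqrt b \<longleftrightarrow> b < a" if "a > 0" "b > 0" for a b
    using that assms(2) by (simp add: divide_less_cancel divide_simps)
  show "r_minus \<epsilon> \<sigma> H L = \<sigma> / sqrt (m + sqrt s)"
    unfolding r_minus_def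
  proof (rule the_equality, goal_cases)
    case 1
    then show ?case using up v w(4) ord W[of "m + sqrt s"] pot assms by auto
  next
    case (2 r)
    define u where "u = \<sigma>^2 / r^2"
    have r: "r = \<sigma> / sqrt u" "u > 0" using sqrt_param[of \<sigma> r] 2 assms by (auto simp: u_def)
    have "?v < u" using 2 v ord[of u ?v] r w(4) by auto
    moreover have "?P u = ?P (m + sqrt s)" using W[of u] 2 r assms pot by auto
    ultimately have "u = m + sqrt s"
      using mono[of u "m + sqrt s"] mono[of "m + sqrt s" u] up
      by (cases u "m + sqrt s" rule: linorder_cases) auto
    then show ?case using r by simp
  qed
  show "r_plus \<epsilon> \<sigma> H L = \<sigma> / sqrt (m - sqrt s)"
    unfolding r_plus_def
  proof (rule the_equality, goal_cases)
    case 1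
    then show ?case using dn v w ord[of ?v "m - sqrt s"] ord[of "m - sqrt s" w] W[of "m - sqrt s"] pot assms
      by auto
  next
    case (2 r)
    define u where "u = \<sigma>^2 / r^2"
    have "0 < r" using 2 v w(4) assms(2)
      by (smt (verit) divide_pos_pos real_sqrt_gt_zero)
    then have r: "r = \<sigma> / sqrt u" "u > 0" using sqrt_param[of \<sigma> r] assms by (auto simp: u_def)
    have "u < ?v" "w < u" using 2 v ord[of ?v u] ord[of u w] r w by auto
    moreover have "?P u = ?P (m - sqrt s)" using W[of u] 2 r assms pot by auto
    ultimately have "u = m - sqrt s"
      using anti[of u "m - sqrt s"] anti[of "m - sqrt s" u] dn assms w
      by (cases u "m - sqrt s" rule: linorder_cases) auto
    then show ?case using r by simp
  qed
qed

section \<open>Period and angle as proper integrals\<close>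

definition kern :: "real \<Rightarrow> real \<Rightarrow> real \<Rightarrow> real \<Rightarrow> real \<Rightarrow> real" where
  "kern p e m s v = (m + v) powr p * quo m s v powr e"

text \<open>The exponent \<open>p\<close> separates the two integrals: -3/2 yields \<open>T\<close>
  and -1/2 yields \<open>\<Theta>\<close>.\<close>

definition orb_int :: "real \<Rightarrow> real \<Rightarrow> real \<Rightarrow> real" where
  "orb_int p m s = integral {0..pi} (\<lambda>t. kern p (-1/2) m s (sqrt s * cos t))"

text \<open>The bounds on \<open>m\<close> surround \<open>2\<^sup>-\<^sup>1\<^sup>/\<^sup>3\<close>.\<close>

lemma quo_pos:
  assumes "78/100 < m" "m < 81/100" "0 \<le> s" "s < 1/100" "\<bar>v\<bar> \<le> 1/10"
  shows "quo m s v > 0"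
proof -
  have m3: "(78/100)^3 \<le> m^3" "m^3 \<le> (81/100)^3" using assms by (intro power_mono; simp)+
  have v2: "v^2 \<le> 1/100" using assms(5) power_mono[of "\<bar>v\<bar>" "1/10" 2] by (simp add: power_divide)
  \<comment> \<open>This leading term exceeds 3, the terms odd in \<open>v\<close> together stay
    below 1 in absolute value, and the remaining terms are nonnegative.\<close>
  have "15*m^4 - 3*m = m * (15 * m^3 - 3)" by algebra
  moreover have "m * (15 * m^3 - 3) \<ge> 78/100 * (15 * (78/100)^3 - 3)"
    using m3 assms by (intro mult_mono) (auto simp: power_divide)
  moreover have "\<bar>(20*m^3 - 1) * v\<bar> \<le> (20 * (81/100)^3 - 1) * (1/10)"
    unfolding abs_mult using m3 assms by (intro mult_mono) (auto simp: power_divide)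
  moreover have "0 \<le> 15*m^2*(s + v^2)" using assms by simp
  moreover have "\<bar>6*m * v * (s + v^2)\<bar> \<le> 6 * (81/100) * (1/10) * (1/100 + 1/100)"
    unfolding abs_mult using v2 assms by (intro mult_mono) auto
  moreover have "0 \<le> s^2 + s * v^2 + v^4" using assms by simp
  ultimately show ?thesis unfolding quo_def by (simp add: power_divide)
qed

lemma sqrt_cos_le:
  assumes "0 \<le> s" "s < 1/100"
  shows "\<bar>sqrt s * cos t\<bar> \<le> 1/10"
proof -
  have "sqrt s \<le> sqrt ((1/10)^2)" using assms by (intro real_sqrt_le_mono) (simp add: power_divide)
  then have "\<bar>sqrt s\<bar> * \<bar>cos t\<bar> \<le> 1/10 * 1" using assms by (intro mult_mono) auto
  then show ?thesis by (simp add: abs_mult)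
qed

lemma continuous_on_quo [continuous_intros]:
  assumes "continuous_on X f" "continuous_on X g" "continuous_on X h"
  shows "continuous_on X (\<lambda>x. quo (f x) (g x) (h x))"
  unfolding quo_def by (intro continuous_intros assms)

lemma continuous_on_kern:
  assumes "continuous_on X f" "continuous_on X g" "continuous_on X h"
    and "\<And>x. x \<in> X \<Longrightarrow> 78/100 < f x \<and> f x < 81/100 \<and> 0 \<le> g x \<and> g x < 1/100 \<and> \<bar>h x\<bar> \<le> 1/10"
  shows "continuous_on X (\<lambda>x. kern p e (f x) (g x) (h x))"
  unfolding kern_def
proof (intro continuous_intros assms(1-3) ballI)
  fix x assume "x \<in> X"
  then show "f x + h x \<noteq> 0" "quo (f x) (g x) (h x) \<noteq> 0"
    using assms(4)[of x] quo_pos[of "f x" "g x" "h x"] by auto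
qed

lemma isCont_W: "r > 0 \<Longrightarrow> isCont (W \<epsilon> \<sigma> L) r"
  unfolding W_def[abs_def] V_def by (intro continuous_intros) auto

text \<open>Substitute r = \<sigma> / sqrt (m + sqrt s cos t). The root of the gap carries a factor
  sqrt s sin t, and so does dr/dt; they cancel, leaving a continuous integrand. The factor r^(-2j)
  contributes u^j and dr/dt contributes u^(-3/2).\<close>

lemma orbit_integral:
  assumes "\<epsilon> > 0" "\<sigma> > 0" "red_level \<epsilon> \<sigma> L = ang m s" "H = 4 * \<epsilon> * en m s"
    and "0 < ang m s" "ang m s < 2/5"
    and ms: "78/100 < m" "m < 81/100" "0 < s" "s < 1/100"
  shows "(LBINT r:{r_minus \<epsilon> \<sigma> H L<..<r_plus \<epsilon> \<sigma> H L}. 1 / (r^(2*j) * sqrt (H - W \<epsilon> \<sigma> L r))) =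
    \<sigma> / (4 * sqrt \<epsilon> * \<sigma>^(2*j)) * orb_int (j - 3/2) m s"
proof -
  define f where "f r = 1 / (r^(2*j) * sqrt (H - W \<epsilon> \<sigma> L r))" for r
  define u where "u t = m + sqrt s * cos t" for t
  define g where "g t = \<sigma> / sqrt (u t)" for t
  define g' where "g' t = \<sigma> * (sqrt s * sin t) / (2 * (u t * sqrt (u t)))" for t
  define K where "K t = kern (j - 3/2) (-1/2) m s (sqrt s * cos t)" for t
  define c where "c = \<sigma> / (4 * sqrt \<epsilon> * \<sigma>^(2*j))"
  have u: "u t > 3/5" for t
    using sqrt_cos_le[of s t] ms by (auto simp: u_def abs_le_iff)
  then have u0: "u t > 0" for t using order_trans[OF _ less_imp_le[OF u[of t]]] u[of t] by linarith
  have q: "quo m s (sqrt s * cos t) > 0" for t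
    using quo_pos[OF ms(1,2) _ ms(4) sqrt_cos_le] ms by auto
  have u_pi: "u 0 = m + sqrt s" "u pi = m - sqrt s" by (auto simp: u_def)
  have rpm: "r_minus \<epsilon> \<sigma> H L = g 0" "r_plus \<epsilon> \<sigma> H L = g pi"
    using r_pm_eq[OF assms(1-6) ms(3)] u[of pi] by (auto simp: g_def u_pi)
  have gap: "H - W \<epsilon> \<sigma> L (g t) = 4 * \<epsilon> * (s * (sin t)^2 * quo m s (sqrt s * cos t))" for t
  proof -
    have "H - W \<epsilon> \<sigma> L (g t) = 4 * \<epsilon> * (en m s - red_pot (ang m s) (u t))"
      using W_at_sqrt[OF assms(1,2) u0[of t], of L] by (simp add: g_def assms algebra_simps)
    also have "en m s - red_pot (ang m s) (u t) = (s - (sqrt s * cos t)^2) * quo m s (sqrt s * cos t)"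
      unfolding u_def by (rule en_minus_red_pot)
    also have "s - (sqrt s * cos t)^2 = s * (sin t)^2"
      using ms by (simp add: power_mult_distrib sin_squared_eq algebra_simps)
    finally show ?thesis .
  qed
  have g_pos: "g t > 0" for t using u0 assms(2) by (simp add: g_def)
  have fg: "f (g t) * g' t = c * K t" if "0 < t" "t < pi" for t
  proof -
    have st: "sin t > 0" using that by (rule sin_gt_zero)
    let ?q = "quo m s (sqrt s * cos t)"
    have e1: "sqrt (H - W \<epsilon> \<sigma> L (g t)) = 2 * sqrt \<epsilon> * (sqrt s * sin t) * sqrt ?q"
      unfolding gap using st by (simp add: real_sqrt_mult)
    have e2: "(g t)^(2*j) = \<sigma>^(2*j) / u t ^ j"
      using u0[of t] by (simp add: g_def power_divide power_mult)
    have "f (g t) * g' t = c * (u t ^ j / (u t * sqrt (u t)) * (1 / sqrt ?q))"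
      using st ms(3) assms(1,2) u0[of t] q[of t]
      unfolding f_def g'_def c_def e1 e2 by (simp add: field_simps)
    also have "u t ^ j / (u t * sqrt (u t)) = u t powr (j - 3/2)"
    proof -
      have "u t powr (3/2) = u t powr (1 + 1/2)" by simp
      also have "\<dots> = u t * sqrt (u t)" using u0[of t] by (simp only: powr_add powr_half_sqrt) simp
      finally show ?thesis using u0[of t] by (simp add: powr_diff powr_realpow)
    qed
    also have "1 / sqrt ?q = ?q powr (-1/2)"
      using q[of t] by (simp add: powr_minus_divide powr_half_sqrt)
    finally show ?thesis by (simp add: K_def kern_def u_def)
  qed
  have contK: "continuous_on {0..pi} (\<lambda>t. c * K t)"
    unfolding K_def using ms sqrt_cos_le
    by (intro continuous_intros continuous_on_kern) auto
  then have intK: "set_integrable lborel {0..pi} (\<lambda>t. c * K t)"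
    by (rule borel_integrable_atLeastAtMost')
  have ein: "einterval (ereal 0) (ereal pi) = {0<..<pi}" by (auto simp: einterval_eq)
  have int_fg: "set_integrable lborel (einterval (ereal 0) (ereal pi)) (\<lambda>t. f (g t) * g' t)"
  proof -
    have "set_integrable lborel {0<..<pi} (\<lambda>t. c * K t)"
      by (rule set_integrable_subset[OF intK]) auto
    then show ?thesis unfolding ein
      by (rule iffD1[OF set_integrable_cong, rotated -1]) (auto simp: fg)
  qed
  have g_cont: "isCont g t" for t
    unfolding g_def u_def using u[of t] u0[of t] by (intro continuous_intros) (auto simp: u_def)
  \<comment> \<open>Since \<open>f\<close> blows up at both turning points, the substitution rule
    for nonnegative integrands is used: it asks for continuity only in the interior, one-sided
    limits of \<open>g\<close> at the ends, and integrability of the transformed integrand.\<close>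
  have "(LBINT r=ereal (g 0)..ereal (g pi). f r) = (LBINT t=ereal 0..ereal pi. f (g t) * g' t)"
  proof (rule interval_integral_substitution_nonneg(2))
    show "ereal 0 < ereal pi" by simp
    fix t assume "ereal 0 < ereal t" "ereal t < ereal pi"
    then have t: "0 < t" "t < pi" by auto
    show "(g has_real_derivative g' t) (at t)"
      unfolding g_def u_def g'_def using u0[of t]
      by (auto intro!: derivative_eq_intros simp: u_def divide_simps)
    show "isCont f (g t)"
      unfolding f_def using g_pos[of t] gap[of t] t sin_gt_zero[of t] assms(1) ms(3) q[of t]
      by (intro continuous_intros isCont_W) auto
    show "isCont g' t"
      unfolding g'_def u_def using u0[of t] by (intro continuous_intros) (auto simp: u_def)
    show "0 \<le> f (g t)"
      unfolding f_def gap using assms(1) ms(3) q[of t] g_pos[of t] by simp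
  next
    fix t assume "ereal 0 \<le> ereal t" "ereal t \<le> ereal pi"
    then show "0 \<le> g' t"
      unfolding g'_def using assms(2) ms(3) u0[of t] sin_ge_zero[of t] by simp
  next
    show "((ereal \<circ> g \<circ> real_of_ereal) \<longlongrightarrow> ereal (g 0)) (at_right (ereal 0))"
      using g_cont by (simp add: ereal_tendsto_simps isCont_def filterlim_at_split)
    show "((ereal \<circ> g \<circ> real_of_ereal) \<longlongrightarrow> ereal (g pi)) (at_left (ereal pi))"
      using g_cont by (simp add: ereal_tendsto_simps isCont_def filterlim_at_split)
  qed (rule int_fg)
  also have "\<dots> = (LBINT t=ereal 0..ereal pi. c * K t)"
    by (rule interval_integral_cong) (auto simp: fg einterval_eq min_def max_def)
  also have "\<dots> = integral {0..pi} (\<lambda>t. c * K t)"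
    using intK by (rule interval_integral_eq_integral[rotated]) simp
  also have "\<dots> = c * orb_int (j - 3/2) m s"
    by (simp add: orb_int_def K_def)
  finally show ?thesis
    using ms u[of pi] u0[of 0] assms(2) unfolding rpm c_def f_def
    by (subst (asm) interval_integral_Ioo) (auto simp: g_def u_pi frac_le)
qed

lemma T_eq:
  assumes "\<epsilon> > 0" "\<sigma> > 0" "red_level \<epsilon> \<sigma> L = ang m s" "H = 4 * \<epsilon> * en m s"
    and "0 < ang m s" "ang m s < 2/5"
    and "78/100 < m" "m < 81/100" "0 < s" "s < 1/100"
  shows "T \<epsilon> \<sigma> H L = sqrt 2 * \<sigma> / (4 * sqrt \<epsilon>) * orb_int (-3/2) m s"
  using orbit_integral[OF assms, of 0] by (simp add: T_def)

lemma \<Theta>_eq: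
  assumes "\<epsilon> > 0" "\<sigma> > 0" "red_level \<epsilon> \<sigma> L = ang m s" "H = 4 * \<epsilon> * en m s"
    and "0 < ang m s" "ang m s < 2/5"
    and "78/100 < m" "m < 81/100" "0 < s" "s < 1/100"
  shows "\<Theta> \<epsilon> \<sigma> H L = sqrt 2 * L / (4 * sqrt \<epsilon> * \<sigma>) * orb_int (-1/2) m s"
  using orbit_integral[OF assms, of 1] assms(2) by (simp add: \<Theta>_def power2_eq_square)

section \<open>Differentiation of the orbit integrals\<close>

definition quo_m :: "real \<Rightarrow> real \<Rightarrow> real \<Rightarrow> real" where
  "quo_m m s v = 60*m^3 - 3 + 60*m^2 * v + 30*m * (s + v^2) + 6 * v * (s + v^2)"

definition quo_s :: "real \<Rightarrow> real \<Rightarrow> real \<Rightarrow> real" where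
  "quo_s m s v = 15*m^2 + 6*m * v + 2 * s + v^2"

definition quo_v :: "real \<Rightarrow> real \<Rightarrow> real \<Rightarrow> real" where
  "quo_v m s v = 20*m^3 - 1 + 30*m^2 * v + 6*m * s + 18*m * v^2 + 2 * s * v + 4 * v^3"

definition quo_vv :: "real \<Rightarrow> real \<Rightarrow> real \<Rightarrow> real" where
  "quo_vv m s v = 30*m^2 + 36*m * v + 2 * s + 12 * v^2"

lemma continuous_on_quo_derivs [continuous_intros]:
  assumes "continuous_on X f" "continuous_on X g" "continuous_on X h"
  shows "continuous_on X (\<lambda>x. quo_m (f x) (g x) (h x))"
    and "continuous_on X (\<lambda>x. quo_s (f x) (g x) (h x))"
    and "continuous_on X (\<lambda>x. quo_v (f x) (g x) (h x))"
    and "continuous_on X (\<lambda>x. quo_vv (f x) (g x) (h x))"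
  unfolding quo_m_def quo_s_def quo_v_def quo_vv_def by (intro continuous_intros assms)+

lemma has_real_derivative_quo:
  assumes "(f has_real_derivative f') (at x within A)" "(g has_real_derivative g') (at x within A)"
    "(h has_real_derivative h') (at x within A)"
  shows "((\<lambda>x. quo (f x) (g x) (h x)) has_real_derivative
    quo_m (f x) (g x) (h x) * f' + quo_s (f x) (g x) (h x) * g' + quo_v (f x) (g x) (h x) * h')
    (at x within A)"
  unfolding quo_def
  by (rule derivative_eq_intros assms refl)+
    (simp add: quo_m_def quo_s_def quo_v_def algebra_simps power_numeral_reduce)

lemma has_real_derivative_quo_v:
  assumes "(h has_real_derivative h') (at x within A)"
  shows "((\<lambda>x. quo_v m s (h x)) has_real_derivative quo_vv m s (h x) * h') (at x within A)"
  unfolding quo_v_def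
  by (rule derivative_eq_intros assms refl)+
    (simp add: quo_vv_def algebra_simps power_numeral_reduce)

lemma has_real_derivative_kern:
  assumes "(f has_real_derivative f') (at x within A)" "(g has_real_derivative g') (at x within A)"
    "(h has_real_derivative h') (at x within A)"
    and "78/100 < f x" "f x < 81/100" "0 \<le> g x" "g x < 1/100" "\<bar>h x\<bar> \<le> 1/10"
  shows "((\<lambda>x. kern p e (f x) (g x) (h x)) has_real_derivative
      p * kern (p - 1) e (f x) (g x) (h x) * (f' + h') + e * kern p (e - 1) (f x) (g x) (h x) *
      (quo_m (f x) (g x) (h x) * f' + quo_s (f x) (g x) (h x) * g' + quo_v (f x) (g x) (h x) * h'))
    (at x within A)"
proof -
  have pos: "f x + h x > 0" "quo (f x) (g x) (h x) > 0"
    using assms(4-8) quo_pos by auto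
  have 1: "((\<lambda>x. (f x + h x) powr p) has_real_derivative
      p * (f x + h x) powr (p - 1) * (f' + h')) (at x within A)"
    by (rule DERIV_chain2[OF has_real_derivative_powr[OF pos(1)] DERIV_add[OF assms(1,3)]])
  have 2: "((\<lambda>x. quo (f x) (g x) (h x) powr e) has_real_derivative
      e * quo (f x) (g x) (h x) powr (e - 1) *
      (quo_m (f x) (g x) (h x) * f' + quo_s (f x) (g x) (h x) * g' + quo_v (f x) (g x) (h x) * h'))
      (at x within A)"
    by (rule DERIV_chain2[OF has_real_derivative_powr[OF pos(2)] has_real_derivative_quo[OF assms(1-3)]])
  show ?thesis
    unfolding kern_def by (rule DERIV_cong[OF DERIV_mult[OF 1 2]]) (simp add: algebra_simps)
qed

definition kern_v :: "real \<Rightarrow> real \<Rightarrow> real \<Rightarrow> real \<Rightarrow> real" where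
  "kern_v p m s v = p * kern (p - 1) (-1/2) m s v - 1/2 * quo_v m s v * kern p (-3/2) m s v"

definition kern_vv :: "real \<Rightarrow> real \<Rightarrow> real \<Rightarrow> real \<Rightarrow> real" where
  "kern_vv p m s v =
     p * ((p - 1) * kern (p - 2) (-1/2) m s v - 1/2 * quo_v m s v * kern (p - 1) (-3/2) m s v)
     - 1/2 * (quo_vv m s v * kern p (-3/2) m s v
       + quo_v m s v * (p * kern (p - 1) (-3/2) m s v - 3/2 * quo_v m s v * kern p (-5/2) m s v))"

lemma has_real_derivative_kern_v:
  assumes "(h has_real_derivative h') (at x within A)"
    and "78/100 < m" "m < 81/100" "0 \<le> s" "s < 1/100" "\<bar>h x\<bar> \<le> 1/10"
  shows "((\<lambda>x. kern_v p m s (h x)) has_real_derivative kern_vv p m s (h x) * h') (at x within A)"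
  unfolding kern_v_def
  by (rule derivative_eq_intros has_real_derivative_kern has_real_derivative_quo_v assms refl)+
    (simp add: kern_vv_def algebra_simps)

definition orb_m :: "real \<Rightarrow> real \<Rightarrow> real \<Rightarrow> real" where
  "orb_m p m s = integral {0..pi} (\<lambda>t. p * kern (p - 1) (-1/2) m s (sqrt s * cos t)
     - 1/2 * quo_m m s (sqrt s * cos t) * kern p (-3/2) m s (sqrt s * cos t))"

text \<open>The naive derivative in \<open>s\<close> contains \<open>kern_v * cos t / (2 * sqrt s)\<close>; integration by
  parts turns it into the term with \<open>kern_vv\<close>, which is continuous up to \<open>s = 0\<close>.\<close>

definition orb_s :: "real \<Rightarrow> real \<Rightarrow> real \<Rightarrow> real" where
  "orb_s p m s = integral {0..pi} (\<lambda>t.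
     1/2 * kern_vv p m s (sqrt s * cos t) * (sin t)^2
     - 1/2 * quo_s m s (sqrt s * cos t) * kern p (-3/2) m s (sqrt s * cos t))"

text \<open>The value s = 0 is included: sqrt s enters these integrands only through sqrt s cos t
  and never as a divisor, so they are jointly continuous with \<open>t\<close> in the compact
  interval.\<close>

lemma continuous_on_orb:
  shows "continuous_on ({78/100<..<81/100} \<times> {0..<1/100}) (\<lambda>x. orb_int p (fst x) (snd x))"
    and "continuous_on ({78/100<..<81/100} \<times> {0..<1/100}) (\<lambda>x. orb_m p (fst x) (snd x))"
    and "continuous_on ({78/100<..<81/100} \<times> {0..<1/100}) (\<lambda>x. orb_s p (fst x) (snd x))"
  unfolding orb_int_def orb_m_def orb_s_def kern_vv_def cbox_interval[symmetric]
  by (rule integral_continuous_on_param; unfold split_beta,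
      intro continuous_intros continuous_on_kern; (use sqrt_cos_le in auto))+

lemma orb_int_deriv_m:
  assumes "78/100 < m" "m < 81/100" "0 \<le> s" "s < 1/100"
  shows "((\<lambda>m. orb_int p m s) has_real_derivative orb_m p m s) (at m)"
proof -
  have "((\<lambda>m. integral (cbox 0 pi) (\<lambda>t. kern p (-1/2) m s (sqrt s * cos t))) has_real_derivative
      integral (cbox 0 pi) (\<lambda>t. p * kern (p - 1) (-1/2) m s (sqrt s * cos t)
      - 1/2 * quo_m m s (sqrt s * cos t) * kern p (-3/2) m s (sqrt s * cos t)))
      (at m within {78/100<..<81/100})"
  proof (rule leibniz_rule_field_derivative)
    fix x t :: real assume x: "x \<in> {78/100<..<81/100}"
    have "((\<lambda>m. kern p (-1/2) m s (sqrt s * cos t)) has_real_derivative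
        p * kern (p - 1) (-1/2) x s (sqrt s * cos t) * (1 + 0)
        + (-1/2) * kern p (-1/2 - 1) x s (sqrt s * cos t) * (quo_m x s (sqrt s * cos t) * 1
          + quo_s x s (sqrt s * cos t) * 0 + quo_v x s (sqrt s * cos t) * 0))
        (at x within {78/100<..<81/100})"
      by (rule has_real_derivative_kern[OF DERIV_ident DERIV_const DERIV_const])
        (use x assms sqrt_cos_le[of s t] in simp_all)
    then show "((\<lambda>m. kern p (-1/2) m s (sqrt s * cos t)) has_real_derivative
        p * kern (p - 1) (-1/2) x s (sqrt s * cos t)
        - 1/2 * quo_m x s (sqrt s * cos t) * kern p (-3/2) x s (sqrt s * cos t))
        (at x within {78/100<..<81/100})"
      by (rule DERIV_cong) simp
  next
    fix x :: real assume "x \<in> {78/100<..<81/100}"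
    then show "(\<lambda>t. kern p (-1/2) x s (sqrt s * cos t)) integrable_on cbox 0 pi"
      using assms sqrt_cos_le[of s]
      by (intro integrable_continuous continuous_intros continuous_on_kern) auto
  next
    show "continuous_on ({78/100<..<81/100} \<times> cbox 0 pi) (\<lambda>(x, t).
        p * kern (p - 1) (-1/2) x s (sqrt s * cos t)
        - 1/2 * quo_m x s (sqrt s * cos t) * kern p (-3/2) x s (sqrt s * cos t))"
      using assms sqrt_cos_le[of s] unfolding split_beta
      by (intro continuous_intros continuous_on_kern) auto
  qed (use assms in auto)
  moreover have "at m within {78/100<..<81/100} = at m"
    using assms by (intro at_within_open) auto
  ultimately show ?thesis by (simp only: orb_int_def orb_m_def cbox_interval)
qed

text \<open>The integrand is the derivative of \<open>kern_v\<close> times sin t, and sin vanishes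
  at 0 and at \<pi>.\<close>

lemma kern_v_by_parts:
  assumes "78/100 < m" "m < 81/100" "0 \<le> s" "s < 1/100"
  shows "((\<lambda>t. kern_v p m s (sqrt s * cos t) * cos t
      - kern_vv p m s (sqrt s * cos t) * (sqrt s * (sin t)^2)) has_integral 0) {0..pi}"
proof -
  have "((\<lambda>t. kern_v p m s (sqrt s * cos t) * sin t) has_real_derivative
      kern_v p m s (sqrt s * cos t) * cos t
      - kern_vv p m s (sqrt s * cos t) * (sqrt s * (sin t)^2)) (at t within {0..pi})" for t
    using assms sqrt_cos_le[of s t]
    by (auto intro!: derivative_eq_intros has_real_derivative_kern_v simp: power2_eq_square)
  then have "((\<lambda>t. kern_v p m s (sqrt s * cos t) * cos t
      - kern_vv p m s (sqrt s * cos t) * (sqrt s * (sin t)^2)) has_integral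
      (kern_v p m s (sqrt s * cos pi) * sin pi - kern_v p m s (sqrt s * cos 0) * sin 0)) {0..pi}"
    by (intro fundamental_theorem_of_calculus)
      (auto simp: has_real_derivative_iff_has_vector_derivative[symmetric])
  then show ?thesis by simp
qed

lemma orb_int_deriv_s:
  assumes "78/100 < m" "m < 81/100" "0 < s" "s < 1/100"
  shows "((\<lambda>s. orb_int p m s) has_real_derivative orb_s p m s) (at s)"
proof -
  \<comment> \<open>The derivative under the integral sign as the chain rule gives it, still with
    the singular factor 1 / sqrt s.\<close>
  define D where "D = (\<lambda>s t. kern_v p m s (sqrt s * cos t) * (cos t / (2 * sqrt s))
    - 1/2 * quo_s m s (sqrt s * cos t) * kern p (-3/2) m s (sqrt s * cos t))"
  have "((\<lambda>s. integral (cbox 0 pi) (\<lambda>t. kern p (-1/2) m s (sqrt s * cos t))) has_real_derivative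
      integral (cbox 0 pi) (D s)) (at s within {0<..<1/100})"
  proof (rule leibniz_rule_field_derivative)
    fix x t :: real assume x: "x \<in> {0<..<1/100}"
    have "((\<lambda>s. sqrt s * cos t) has_real_derivative cos t / (2 * sqrt x)) (at x within {0<..<1/100})"
      using x by (auto intro!: derivative_eq_intros simp: divide_simps)
    note h = this
    have "((\<lambda>s. kern p (-1/2) m s (sqrt s * cos t)) has_real_derivative
        p * kern (p - 1) (-1/2) m x (sqrt x * cos t) * (0 + cos t / (2 * sqrt x))
        + (-1/2) * kern p (-1/2 - 1) m x (sqrt x * cos t) * (quo_m m x (sqrt x * cos t) * 0
          + quo_s m x (sqrt x * cos t) * 1 + quo_v m x (sqrt x * cos t) * (cos t / (2 * sqrt x))))
        (at x within {0<..<1/100})"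
      by (rule has_real_derivative_kern[OF DERIV_const DERIV_ident h])
        (use x assms sqrt_cos_le[of x t] in simp_all)
    then show "((\<lambda>s. kern p (-1/2) m s (sqrt s * cos t)) has_real_derivative D x t)
        (at x within {0<..<1/100})"
      by (rule DERIV_cong) (simp add: D_def kern_v_def algebra_simps)
  next
    fix x :: real assume "x \<in> {0<..<1/100}"
    then show "(\<lambda>t. kern p (-1/2) m x (sqrt x * cos t)) integrable_on cbox 0 pi"
      using assms sqrt_cos_le[of x]
      by (intro integrable_continuous continuous_intros continuous_on_kern) auto
  next
    show "continuous_on ({0<..<1/100} \<times> cbox 0 pi) (\<lambda>(x, t). D x t)"
      using assms sqrt_cos_le unfolding split_beta D_def kern_v_def
      by (intro continuous_intros continuous_on_kern) auto
  qed (use assms in auto)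
  moreover have "integral {0..pi} (D s) = orb_s p m s"
  proof -
    let ?S = "\<lambda>t. 1/2 * kern_vv p m s (sqrt s * cos t) * (sin t)^2
     - 1/2 * quo_s m s (sqrt s * cos t) * kern p (-3/2) m s (sqrt s * cos t)"
    have "?S integrable_on {0..pi}"
      unfolding kern_vv_def cbox_interval[symmetric] using assms sqrt_cos_le[of s]
      by (intro integrable_continuous continuous_intros continuous_on_kern) auto
    then have "(?S has_integral orb_s p m s) {0..pi}"
      unfolding orb_s_def by (rule integrable_integral)
    \<comment> \<open>Adding a multiple of the vanishing integral from
      \<open>kern_v_by_parts\<close> changes the regular integrand into \<open>D s\<close> without
      changing the integral.\<close>
    then have "((\<lambda>t. ?S t + 1 / (2 * sqrt s) * (kern_v p m s (sqrt s * cos t) * cos t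
      - kern_vv p m s (sqrt s * cos t) * (sqrt s * (sin t)^2))) has_integral
        orb_s p m s + 1 / (2 * sqrt s) * 0) {0..pi}"
      using assms by (intro has_integral_add has_integral_mult_right kern_v_by_parts) auto
    also have "(\<lambda>t. ?S t + 1 / (2 * sqrt s) * (kern_v p m s (sqrt s * cos t) * cos t
      - kern_vv p m s (sqrt s * cos t) * (sqrt s * (sin t)^2))) = D s"
      using assms by (auto simp: D_def field_simps)
    finally show ?thesis by (simp add: integral_unique)
  qed
  moreover have "at s within {0<..<1/100} = at s"
    using assms by (intro at_within_open) auto
  ultimately show ?thesis by (simp only: orb_int_def cbox_interval)
qed

text \<open>Total differentiability follows from the two partial derivatives because the one in
  \<open>s\<close> is continuous.\<close>

lemma orb_int_has_derivative:
  assumes "78/100 < m" "m < 81/100" "0 < s" "s < 1/100"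
  shows "((\<lambda>x. orb_int p (fst x) (snd x)) has_derivative
    (\<lambda>y. orb_m p m s * fst y + orb_s p m s * snd y)) (at (m, s))"
proof -
  let ?X = "{78/100<..<81/100::real}" and ?Y = "{0<..<1/100::real}"
  have "((\<lambda>(m, s). orb_int p m s) has_derivative
      (\<lambda>(tx, ty). orb_m p m s * tx + blinfun_mult_right (orb_s p m s) ty)) (at (m, s) within ?X \<times> ?Y)"
  proof (rule has_derivative_partialsI)
    show "((\<lambda>x. orb_int p x s) has_derivative (*) (orb_m p m s)) (at m within ?X)"
      using orb_int_deriv_m[of m s p] assms
      by (auto simp: has_field_derivative_def intro: has_derivative_at_withinI)
    show "((\<lambda>y. orb_int p x y) has_derivative blinfun_apply (blinfun_mult_right (orb_s p x y)))
        (at y within ?Y)" if "x \<in> ?X" "y \<in> ?Y" for x y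
      using orb_int_deriv_s[of x y p] that
      by (auto simp: has_field_derivative_def intro: has_derivative_at_withinI)
    have "continuous_on (?X \<times> ?Y) (\<lambda>x. blinfun_mult_right (orb_s p (fst x) (snd x)))"
      by (intro bounded_linear.continuous_on[OF bounded_linear_blinfun_mult_right]
          continuous_on_subset[OF continuous_on_orb(3)]) auto
    moreover have "(m, s) \<in> ?X \<times> ?Y" using assms by auto
    ultimately show "continuous (at (m, s) within ?X \<times> ?Y) (\<lambda>(x, y). blinfun_mult_right (orb_s p x y))"
      unfolding case_prod_unfold continuous_on_eq_continuous_within by (rule bspec)
  qed (use assms in auto)
  moreover have "at (m, s) within ?X \<times> ?Y = at (m, s)"
    using assms by (intro at_within_open) (auto intro: open_Times)
  ultimately show ?thesis by (simp add: split_beta')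
qed

lemma orb_int_pos:
  assumes "78/100 < m" "m < 81/100"
  shows "orb_int p m 0 > 0"
  using assms quo_pos[of m 0 0] by (simp add: orb_int_def kern_def)

section \<open>The determinant in orbit coordinates\<close>

definition ang_m :: "real \<Rightarrow> real \<Rightarrow> real" where
  "ang_m m s = 6*m - 30*m^4 - 60*m^2 * s - 6 * s^2"

definition ang_s :: "real \<Rightarrow> real \<Rightarrow> real" where
  "ang_s m s = 1 - 20*m^3 - 12*m * s"

definition en_m :: "real \<Rightarrow> real \<Rightarrow> real" where
  "en_m m s = ang_m m s * m + (40*m^3 - 2) * s + 24*m * s^2"

definition en_s :: "real \<Rightarrow> real \<Rightarrow> real" where
  "en_s m s = ang_s m s * m + 15*m^4 - 3*m + 30*m^2 * s + 3 * s^2"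

definition jac :: "real \<Rightarrow> real \<Rightarrow> real" where
  "jac m s = ang_m m s * en_s m s - ang_s m s * en_m m s"

text \<open>\<open>orb_ang\<close> and \<open>orb_en\<close> are the partial derivatives of \<open>orb_int\<close> with respect to the values of
  \<open>ang\<close> and \<open>en\<close>, obtained with the inverse Jacobian matrix.\<close>

definition orb_ang :: "real \<Rightarrow> real \<Rightarrow> real \<Rightarrow> real" where
  "orb_ang p m s = (orb_m p m s * en_s m s - orb_s p m s * en_m m s) / jac m s"

definition orb_en :: "real \<Rightarrow> real \<Rightarrow> real \<Rightarrow> real" where
  "orb_en p m s = (orb_s p m s * ang_m m s - orb_m p m s * ang_s m s) / jac m s"

text \<open>This is \<open>\<D>\<close> up to a positive constant. With \<alpha> the level of L, L
  d\<alpha>/dL = 2 \<alpha> explains the factors \<open>2 * ang m s\<close>, and the bare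
  \<open>orb_int\<close> comes from differentiating the prefactor L of
  \<open>\<Theta>\<close>.\<close>

definition red_det :: "real \<Rightarrow> real \<Rightarrow> real" where
  "red_det m s = orb_en (-3/2) m s * (orb_int (-1/2) m s + 2 * ang m s * orb_ang (-1/2) m s)
     - 2 * ang m s * orb_ang (-3/2) m s * orb_en (-1/2) m s"

lemma continuous_on_coords [continuous_intros]:
  assumes "continuous_on X f" "continuous_on X g"
  shows "continuous_on X (\<lambda>x. ang (f x) (g x))" "continuous_on X (\<lambda>x. en (f x) (g x))"
    "continuous_on X (\<lambda>x. ang_m (f x) (g x))" "continuous_on X (\<lambda>x. ang_s (f x) (g x))"
    "continuous_on X (\<lambda>x. en_m (f x) (g x))" "continuous_on X (\<lambda>x. en_s (f x) (g x))"
    "continuous_on X (\<lambda>x. jac (f x) (g x))"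
  unfolding jac_def en_m_def en_s_def en_def ang_def ang_m_def ang_s_def
  by (intro continuous_intros assms)+

lemma coords_has_derivative:
  "((\<lambda>x. (ang (fst x) (snd x), en (fst x) (snd x))) has_derivative
    (\<lambda>y. (ang_m (fst x) (snd x) * fst y + ang_s (fst x) (snd x) * snd y,
      en_m (fst x) (snd x) * fst y + en_s (fst x) (snd x) * snd y))) (at x)"
proof (intro has_derivative_Pair)
  show ang: "((\<lambda>x. ang (fst x) (snd x)) has_derivative
      (\<lambda>y. ang_m (fst x) (snd x) * fst y + ang_s (fst x) (snd x) * snd y)) (at x)"
    unfolding ang_def
    by (rule derivative_eq_intros refl)+
      (simp add: fun_eq_iff ang_m_def ang_s_def algebra_simps power_numeral_reduce)
  show "((\<lambda>x. en (fst x) (snd x)) has_derivative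
      (\<lambda>y. en_m (fst x) (snd x) * fst y + en_s (fst x) (snd x) * snd y)) (at x)"
    unfolding en_def
    by (rule derivative_eq_intros ang refl)+
      (simp add: fun_eq_iff ang_def ang_m_def ang_s_def en_m_def en_s_def algebra_simps power_numeral_reduce)
qed

text \<open>The domain contains the boundary s = 0, which is what later allows passing to the limit
  at circular orbits; a negative Jacobian makes the quotients continuous.\<close>

lemma continuous_on_red_det:
  "continuous_on ({78/100<..<81/100} \<times> {0..<1/100} \<inter> {x. jac (fst x) (snd x) < 0})
    (\<lambda>x. red_det (fst x) (snd x))"
  unfolding red_det_def orb_en_def orb_ang_def
  by (intro continuous_intros continuous_on_subset[OF continuous_on_orb(1)]
    continuous_on_subset[OF continuous_on_orb(2)] continuous_on_subset[OF continuous_on_orb(3)]) auto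

section \<open>Explicit evaluation at the minimum with zero angular momentum\<close>

lemma integral_sin_squared: "((\<lambda>t. (sin t)^2) has_integral pi / 2) {0..pi}"
proof -
  have "((\<lambda>t. (t - sin t * cos t) / 2) has_real_derivative (sin t)^2) (at t within {0..pi})" for t
  proof -
    have "((\<lambda>t. (t - sin t * cos t) / 2) has_real_derivative
        (1 - (cos t * cos t + sin t * - sin t)) / 2) (at t within {0..pi})"
      by (auto intro!: derivative_eq_intros)
    then show ?thesis
      by (rule DERIV_cong) (simp add: sin_squared_eq power2_eq_square[symmetric])
  qed
  then have "((\<lambda>t. (sin t)^2) has_integral
      (pi - sin pi * cos pi) / 2 - (0 - sin 0 * cos 0) / 2) {0..pi}"
    by (intro fundamental_theorem_of_calculus)
      (auto simp: has_real_derivative_iff_has_vector_derivative[symmetric])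
  then show ?thesis by simp
qed

text \<open>At (M, 0) the level \<open>ang\<close> vanishes, so \<open>red_det\<close> reduces to
  \<open>orb_en (-3/2)\<close> times the positive \<open>orb_int (-1/2)\<close>. The first factor is
  computed exactly.\<close>

lemma red_det_pos:
  assumes "M > 0" "M^3 = 1/2" "78/100 < M" "M < 81/100"
  shows "red_det M 0 > 0" and "jac M 0 < 0"
proof -
  \<comment> \<open>This is the value 15 M^4 - 3 M of \<open>quo\<close> at (M, 0, 0). All kernel
    values needed below are rational multiples of \<open>K\<close> divided by powers of
    \<open>M\<close> and \<open>q\<close>.\<close>
  define q where "q = 9/2 * M"
  define K where "K = M powr (-3/2) * q powr (-1/2)"
  have q: "q > 0" and K: "K > 0" using assms by (auto simp: q_def K_def)
  have M4: "M^4 = M / 2" using assms(2) by (simp add: power_numeral_reduce)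
  have M5: "M^5 = M^2 / 2" using assms(2) by (simp add: power_numeral_reduce)
  have ev: "quo M 0 0 = q" "quo_m M 0 0 = 27" "quo_v M 0 0 = 9" "quo_s M 0 0 = 15 * M^2"
      "quo_vv M 0 0 = 30 * M^2" "ang M 0 = 0" "ang_m M 0 = - 9 * M" "ang_s M 0 = - 9"
      "en_m M 0 = - 9 * M^2" "en_s M 0 = - 9/2 * M"
    by (auto simp: assms(2) quo_def quo_m_def quo_v_def quo_s_def quo_vv_def q_def
        ang_def ang_m_def ang_s_def en_m_def en_s_def M4 M5 power2_eq_square)
  have jac: "jac M 0 = - 81/2 * M^2" by (simp add: jac_def ev power2_eq_square)
  then show "jac M 0 < 0" using assms by simp
  have pw: "M powr (- (5/2)) = M powr (- (3/2)) / M" "M powr (- (7/2)) = M powr (- (3/2)) / M^2"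
    "q powr (- (3/2)) = q powr (- (1/2)) / q" "q powr (- (5/2)) = q powr (- (1/2)) / q^2"
    using assms(1) q powr_diff[of M "-3/2" 1] powr_diff[of M "-3/2" 2]
      powr_diff[of q "-1/2" 1] powr_diff[of q "-1/2" 2] by auto
  have k: "kern (- (3/2)) (- (1/2)) M 0 0 = K" "kern (- (5/2)) (- (1/2)) M 0 0 = K / M"
    "kern (- (7/2)) (- (1/2)) M 0 0 = K / M^2" "kern (- (3/2)) (- (3/2)) M 0 0 = K / q"
    "kern (- (5/2)) (- (3/2)) M 0 0 = K / (M * q)" "kern (- (3/2)) (- (5/2)) M 0 0 = K / q^2"
    by (auto simp: kern_def ev K_def pw field_simps)
  have om: "orb_m (- (3/2)) M 0 = pi * (- 9/2 * K / M)"
    using assms(1) by (simp add: orb_m_def k ev q_def field_simps)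
  have os: "orb_s (- (3/2)) M 0 = pi * (19/16 * K / M^2)"
  proof -
    have "kern_vv (- (3/2)) M 0 0 = K * (39/4 / M^2 - 10/3 * M)"
      using assms(1) by (simp add: kern_vv_def k ev q_def field_simps power2_eq_square)
    \<comment> \<open>Inserting M^3 = 1/2 brings both terms to the common denominator M^2.\<close>
    also have "10/3 * M = 10/3 * M^3 / M^2" using assms(1) by (simp add: power_numeral_reduce)
    also have "\<dots> = 5/3 / M^2" using assms(2) by simp
    finally have vv: "kern_vv (- (3/2)) M 0 0 = 97/12 * K / M^2" by (simp add: field_simps)
    have s: "1/2 * (15 * M^2) * (K / q) = 5/6 * K / M^2"
    proof -
      have "1/2 * (15 * M^2) * (K / q) = 5/3 * K * M^3 / M^2"
        using assms(1) by (simp add: q_def power_numeral_reduce)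
      then show ?thesis using assms(2) by simp
    qed
    have "((\<lambda>t. 97/24 * K / M^2 * (sin t)^2 - 5/6 * K / M^2) has_integral
        97/24 * K / M^2 * (pi/2) - pi * (5/6 * K / M^2)) {0..pi}"
      using has_integral_const_real[of "5/6 * K / M^2" 0 pi]
      by (intro has_integral_diff has_integral_mult_right integral_sin_squared) simp
    moreover have "(\<lambda>t. 1/2 * kern_vv (-3/2) M 0 (sqrt 0 * cos t) * (sin t)^2
       - 1/2 * quo_s M 0 (sqrt 0 * cos t) * kern (-3/2) (-3/2) M 0 (sqrt 0 * cos t))
       = (\<lambda>t. 97/24 * K / M^2 * (sin t)^2 - 5/6 * K / M^2)"
      using s by (simp add: vv k ev)
    ultimately have "orb_s (- (3/2)) M 0 = 97/24 * K / M^2 * (pi/2) - pi * (5/6 * K / M^2)"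
      unfolding orb_s_def by (simp add: integral_unique)
    then show ?thesis by (simp add: field_simps)
  qed
  have "orb_en (- (3/2)) M 0 = pi * (91/16 * K / M) * 9 / (81/2 * M^2)"
    unfolding orb_en_def om os jac ev using assms(1) by (simp add: field_simps power2_eq_square)
  then have "orb_en (- (3/2)) M 0 > 0" using K assms(1) by simp
  then show "red_det M 0 > 0"
    using orb_int_pos[of M "-1/2"] assms by (simp add: red_det_def ev)
qed

section \<open>Local inversion of the coordinate map and the chain rule for
  \<open>\<D>\<close>\<close>

definition coords :: "real \<times> real \<Rightarrow> real \<times> real" where
  "coords x = (ang (fst x) (snd x), en (fst x) (snd x))"

definition coords_D :: "real \<times> real \<Rightarrow> real \<times> real \<Rightarrow> real \<times> real" where
  "coords_D x y = (ang_m (fst x) (snd x) * fst y + ang_s (fst x) (snd x) * snd y,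
      en_m (fst x) (snd x) * fst y + en_s (fst x) (snd x) * snd y)"

definition coords_inv_D :: "real \<times> real \<Rightarrow> real \<times> real \<Rightarrow> real \<times> real" where
  "coords_inv_D x y =
     ((en_s (fst x) (snd x) * fst y - ang_s (fst x) (snd x) * snd y) / jac (fst x) (snd x),
      (ang_m (fst x) (snd x) * snd y - en_m (fst x) (snd x) * fst y) / jac (fst x) (snd x))"

lemma bounded_linear_coords_D:
  "bounded_linear (coords_D x)" "bounded_linear (coords_inv_D x)"
  unfolding coords_D_def[abs_def] coords_inv_D_def[abs_def] divide_inverse
  by (intro bounded_linear_intros)+

lemma coords_D_inverse:
  assumes "jac (fst x) (snd x) \<noteq> 0"
  shows "coords_inv_D x \<circ> coords_D x = id" "coords_D x \<circ> coords_inv_D x = id"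
proof -
  define a b c d where "a = ang_m (fst x) (snd x)" and "b = ang_s (fst x) (snd x)"
    and "c = en_m (fst x) (snd x)" and "d = en_s (fst x) (snd x)"
  define j where "j = jac (fst x) (snd x)"
  have j: "j = a * d - b * c" by (simp add: jac_def a_def b_def c_def d_def j_def)
  have "j \<noteq> 0" using assms by (simp add: j_def)
  then show "coords_inv_D x \<circ> coords_D x = id" "coords_D x \<circ> coords_inv_D x = id"
    unfolding coords_D_def coords_inv_D_def j_def[symmetric] fun_eq_iff
      a_def[symmetric] b_def[symmetric] c_def[symmetric] d_def[symmetric]
    by (auto simp: field_simps) (simp_all add: j algebra_simps)
qed

lemma continuous_on_Blinfun_coords_D: "continuous_on X (\<lambda>x. Blinfun (coords_D x))"
proof (rule continuous_on_blinfun_componentwise)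
  fix i :: "real \<times> real"
  have "continuous_on X (\<lambda>x. coords_D x i)"
    unfolding coords_D_def by (intro continuous_intros)
  then show "continuous_on X (\<lambda>x. blinfun_apply (Blinfun (coords_D x)) i)"
    by (simp add: bounded_linear_Blinfun_apply bounded_linear_coords_D)
qed

text \<open>The inverse function theorem supplies the local inverse; uniqueness of inverse maps
  identifies its derivative with the explicit matrix \<open>coords_inv_D\<close>.\<close>

lemma coords_local_inverse:
  assumes "open U0" "x0 \<in> U0" "jac (fst x0) (snd x0) \<noteq> 0"
  obtains U V g where "open U" "U \<subseteq> U0" "x0 \<in> U" "open V" "coords x0 \<in> V"
    "homeomorphism U V coords g"
    "\<And>y. y \<in> V \<Longrightarrow> jac (fst (g y)) (snd (g y)) \<noteq> 0 \<Longrightarrow>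
      (g has_derivative coords_inv_D (g y)) (at y)"
proof -
  have app: "blinfun_apply (Blinfun (coords_D x)) = coords_D x"
      "blinfun_apply (Blinfun (coords_inv_D x)) = coords_inv_D x" for x
    by (simp_all add: bounded_linear_Blinfun_apply bounded_linear_coords_D)
  have inv: "Blinfun (coords_inv_D x0) o\<^sub>L Blinfun (coords_D x0) = id_blinfun"
    using coords_D_inverse(1)[OF assms(3)]
    by (intro blinfun_eqI) (auto simp: app dest: fun_cong)
  have der: "(coords has_derivative blinfun_apply (Blinfun (coords_D x))) (at x)" for x
    unfolding app(1) using coords_has_derivative[of x]
    by (simp add: coords_def[abs_def] coords_D_def[abs_def])
  obtain U V g g' where IFT: "open U" "U \<subseteq> U0" "x0 \<in> U" "open V" "coords x0 \<in> V"
      "homeomorphism U V coords g"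
      "\<And>y. y \<in> V \<Longrightarrow> (g has_derivative (g' y)) (at y)"
      "\<And>y. y \<in> V \<Longrightarrow> g' y = inv (blinfun_apply (Blinfun (coords_D (g y))))"
    using inverse_function_theorem[OF assms(1) der continuous_on_Blinfun_coords_D assms(2) inv]
    by metis
  have "(g has_derivative coords_inv_D (g y)) (at y)"
    if "y \<in> V" "jac (fst (g y)) (snd (g y)) \<noteq> 0" for y
    using IFT(7,8)[OF that(1)] coords_D_inverse[OF that(2)] inv_unique_comp
    by (metis app(1))
  then show ?thesis using that IFT(1-6) by blast
qed

text \<open>Negative \<open>s\<close> is allowed so that the set is an open neighbourhood of
  (2^(-1/3), 0), as inversion requires. The signs of \<open>jac\<close> and \<open>ang_m\<close>
  make \<open>s\<close> increase with the energy at fixed level, and the bound 2/5 gives access to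
  the critical points.\<close>

definition orbit_region :: "(real \<times> real) set" where
  "orbit_region = {x. 78/100 < fst x \<and> fst x < 81/100 \<and> snd x < 1/100 \<and>
     jac (fst x) (snd x) < 0 \<and> ang_m (fst x) (snd x) < 0 \<and> ang (fst x) (snd x) < 2/5}"

lemma red_level_pos: "\<epsilon> > 0 \<Longrightarrow> \<sigma> > 0 \<Longrightarrow> L > 0 \<Longrightarrow> red_level \<epsilon> \<sigma> L > 0"
  by (simp add: red_level_def)

lemma red_level_deriv:
  "L \<noteq> 0 \<Longrightarrow> (red_level \<epsilon> \<sigma> has_real_derivative 2 * red_level \<epsilon> \<sigma> L / L) (at L)"
  unfolding red_level_def[abs_def]
  by (rule DERIV_cong[OF DERIV_cdivide[OF DERIV_pow]]) (simp add: power2_eq_square)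

text \<open>Near (H, L) both \<open>T\<close> and \<open>\<Theta>\<close> are explicit prefactors
  times \<open>orb_int\<close> composed with \<open>g\<close>; the four partial derivatives follow
  by the chain rule and combine into \<open>red_det\<close>.\<close>

lemma D_formula:
  assumes "\<epsilon> > 0" "\<sigma> > 0" "L > 0"
    and Y: "open Y" "homeomorphism U Y coords g" and U: "U \<subseteq> orbit_region"
    and g: "\<And>y. y \<in> Y \<Longrightarrow> (g has_derivative coords_inv_D (g y)) (at y)"
    and y0: "(red_level \<epsilon> \<sigma> L, H / (4 * \<epsilon>)) \<in> Y"
    and ms: "g (red_level \<epsilon> \<sigma> L, H / (4 * \<epsilon>)) = (m, s)" "s > 0"
  shows "\<D> \<epsilon> \<sigma> H L = red_det m s / (32 * \<epsilon>^2)"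
proof -
  define y0 where "y0 = (red_level \<epsilon> \<sigma> L, H / (4 * \<epsilon>))"
  \<comment> \<open>The part of \<open>Y\<close> with s > 0, where the turning points are distinct
    and the integral formulas hold. Its openness lets the derivatives of \<open>T\<close> and
    \<open>\<Theta>\<close> be read off from these formulas.\<close>
  define Y' where "Y' = Y \<inter> g -` {x. 0 < snd x}"
  define F where "F p y = orb_int p (fst (g y)) (snd (g y))" for p y
  have "open Y'"
    unfolding Y'_def using Y homeomorphism_cont2[OF Y(2)]
    by (intro continuous_open_preimage open_Collect_less continuous_intros) auto
  have y0Y: "y0 \<in> Y'" using y0 ms by (simp add: Y'_def y0_def)
  have coords: "coords (g y) = y" "g y \<in> orbit_region" "0 < snd (g y)" if "y \<in> Y'" for y
    using that Y(2) U by (auto simp: Y'_def homeomorphism_def)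
  have T: "T \<epsilon> \<sigma> h l = sqrt 2 * \<sigma> / (4 * sqrt \<epsilon>) * F (-3/2) (red_level \<epsilon> \<sigma> l, h / (4 * \<epsilon>))"
    and \<Theta>: "\<Theta> \<epsilon> \<sigma> h l = sqrt 2 * l / (4 * sqrt \<epsilon> * \<sigma>) * F (-1/2) (red_level \<epsilon> \<sigma> l, h / (4 * \<epsilon>))"
    if "(red_level \<epsilon> \<sigma> l, h / (4 * \<epsilon>)) \<in> Y'" "l > 0" for h l
  proof -
    let ?y = "(red_level \<epsilon> \<sigma> l, h / (4 * \<epsilon>))"
    have *: "red_level \<epsilon> \<sigma> l = ang (fst (g ?y)) (snd (g ?y))" "h / (4 * \<epsilon>) = en (fst (g ?y)) (snd (g ?y))"
      using coords(1)[OF that(1)] by (auto simp: coords_def)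
    have "h = 4 * \<epsilon> * en (fst (g ?y)) (snd (g ?y))" using assms(1) by (simp add: *(2)[symmetric])
    moreover have "0 < ang (fst (g ?y)) (snd (g ?y))"
      using red_level_pos[OF assms(1,2) that(2)] by (simp add: *(1)[symmetric])
    ultimately show "T \<epsilon> \<sigma> h l = sqrt 2 * \<sigma> / (4 * sqrt \<epsilon>) * F (-3/2) ?y"
      "\<Theta> \<epsilon> \<sigma> h l = sqrt 2 * l / (4 * sqrt \<epsilon> * \<sigma>) * F (-1/2) ?y"
      unfolding F_def using T_eq[OF assms(1,2) *(1)] \<Theta>_eq[OF assms(1,2) *(1)] coords(2,3)[OF that(1)]
      by (auto simp: orbit_region_def)
  qed
  have gy0: "g y0 = (m, s)" using ms by (simp add: y0_def)
  have reg: "78/100 < m" "m < 81/100" "s < 1/100" "jac m s < 0"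
    using coords(2)[OF y0Y] by (auto simp: orbit_region_def gy0)
  have F: "(F p has_derivative (\<lambda>z. orb_ang p m s * fst z + orb_en p m s * snd z)) (at y0)" for p
  proof -
    have "((\<lambda>x. orb_int p (fst x) (snd x)) has_derivative
        (\<lambda>y. orb_m p m s * fst y + orb_s p m s * snd y)) (at (g y0))"
      unfolding gy0 using reg ms by (intro orb_int_has_derivative) auto
    moreover have "(g has_derivative coords_inv_D (m, s)) (at y0)"
      using g[of y0] y0Y gy0 by (auto simp: Y'_def)
    ultimately have "(F p has_derivative (\<lambda>z. orb_m p m s * fst (coords_inv_D (m, s) z)
        + orb_s p m s * snd (coords_inv_D (m, s) z))) (at y0)"
      using diff_chain_at[of g "coords_inv_D (m, s)" y0] by (auto simp: F_def[abs_def] comp_def)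
    also have "(\<lambda>z. orb_m p m s * fst (coords_inv_D (m, s) z)
        + orb_s p m s * snd (coords_inv_D (m, s) z)) =
        (\<lambda>z. orb_ang p m s * fst z + orb_en p m s * snd z)"
      using reg by (auto simp: coords_inv_D_def orb_ang_def orb_en_def fun_eq_iff field_simps)
    finally show ?thesis .
  qed
  have FH: "((\<lambda>h. F p (red_level \<epsilon> \<sigma> L, h / (4 * \<epsilon>))) has_real_derivative
      orb_en p m s / (4 * \<epsilon>)) (at H)" for p
  proof -
    have "((\<lambda>h. (red_level \<epsilon> \<sigma> L, h / (4 * \<epsilon>))) has_derivative (\<lambda>h. (0, h / (4 * \<epsilon>)))) (at H)"
      using assms(1) by (auto intro!: derivative_eq_intros)
    from has_derivative_compose[OF this F[unfolded y0_def]]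
    show ?thesis by (rule has_derivative_imp_has_field_derivative) simp
  qed
  have FL: "((\<lambda>l. F p (red_level \<epsilon> \<sigma> l, H / (4 * \<epsilon>))) has_real_derivative
      orb_ang p m s * (2 * red_level \<epsilon> \<sigma> L / L)) (at L)" for p
  proof -
    have "((\<lambda>l. (red_level \<epsilon> \<sigma> l, H / (4 * \<epsilon>))) has_derivative
        (\<lambda>l. (2 * red_level \<epsilon> \<sigma> L / L * l, 0))) (at L)"
      using red_level_deriv[of L \<epsilon> \<sigma>] assms(3)
      by (intro has_derivative_Pair has_derivative_const)
        (simp only: has_field_derivative_def less_imp_neq[symmetric] simp_thms)
    from has_derivative_compose[OF this F[unfolded y0_def]]
    show ?thesis by (rule has_derivative_imp_has_field_derivative) simp
  qed
  have openH: "open {h. (red_level \<epsilon> \<sigma> L, h / (4 * \<epsilon>)) \<in> Y'}"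
  proof -
    have "continuous_on UNIV (\<lambda>h. (red_level \<epsilon> \<sigma> L, h / (4 * \<epsilon>)))"
      unfolding divide_inverse by (intro continuous_intros)
    from open_vimage[OF \<open>open Y'\<close> this] show ?thesis by (simp add: vimage_def)
  qed
  have openL: "open {l. 0 < l \<and> (red_level \<epsilon> \<sigma> l, H / (4 * \<epsilon>)) \<in> Y'}"
  proof -
    have "continuous_on UNIV (\<lambda>l. (red_level \<epsilon> \<sigma> l, H / (4 * \<epsilon>)))"
      unfolding red_level_def divide_inverse by (intro continuous_intros)
    from open_vimage[OF \<open>open Y'\<close> this] have "open {l. (red_level \<epsilon> \<sigma> l, H / (4 * \<epsilon>)) \<in> Y'}"
      by (simp add: vimage_def)
    then show ?thesis by (intro open_Collect_conj open_Collect_less continuous_intros)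
  qed
  define A B where "A = sqrt 2 * \<sigma> / (4 * sqrt \<epsilon>)" and "B = sqrt 2 / (4 * sqrt \<epsilon> * \<sigma>)"
  have TH: "deriv (\<lambda>h. T \<epsilon> \<sigma> h L) H = A * (orb_en (-3/2) m s / (4 * \<epsilon>))"
    by (rule DERIV_imp_deriv, rule has_field_derivative_transform_within_open[OF DERIV_cmult[OF FH] openH])
      (use y0Y T assms(3) in \<open>auto simp: A_def y0_def\<close>)
  have \<Theta>H: "deriv (\<lambda>h. \<Theta> \<epsilon> \<sigma> h L) H = B * L * (orb_en (-1/2) m s / (4 * \<epsilon>))"
    by (rule DERIV_imp_deriv, rule has_field_derivative_transform_within_open[OF DERIV_cmult[OF FH] openH])
      (use y0Y \<Theta> assms(3) in \<open>auto simp: B_def y0_def\<close>)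
  have TL: "deriv (\<lambda>l. T \<epsilon> \<sigma> H l) L = A * (orb_ang (-3/2) m s * (2 * red_level \<epsilon> \<sigma> L / L))"
    by (rule DERIV_imp_deriv, rule has_field_derivative_transform_within_open[OF DERIV_cmult[OF FL] openL])
      (use y0Y T assms(3) in \<open>auto simp: A_def y0_def\<close>)
  have \<Theta>L: "deriv (\<lambda>l. \<Theta> \<epsilon> \<sigma> H l) L =
      B * (L * (orb_ang (-1/2) m s * (2 * red_level \<epsilon> \<sigma> L / L)) + 1 * F (-1/2) y0)"
    unfolding y0_def
    by (rule DERIV_imp_deriv, rule has_field_derivative_transform_within_open
        [OF DERIV_cmult[OF DERIV_mult'[OF DERIV_ident FL]] openL])
      (use y0Y \<Theta> assms(3) in \<open>auto simp: B_def y0_def\<close>)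
  have ang: "red_level \<epsilon> \<sigma> L = ang m s"
    using coords(1)[OF y0Y] gy0 by (auto simp: coords_def y0_def)
  have F0: "F (-1/2) y0 = orb_int (-1/2) m s" by (simp add: F_def gy0)
  have "\<D> \<epsilon> \<sigma> H L = A * B / (4 * \<epsilon>) * red_det m s"
    unfolding \<D>_def TH \<Theta>H TL \<Theta>L red_det_def F0 ang using assms(1,3) by (simp add: field_simps)
  moreover have "A * B = 1 / (8 * \<epsilon>)"
    using assms(1,2) by (simp add: A_def B_def field_simps)
  ultimately show ?thesis using assms(1) by (simp add: power2_eq_square)
qed

section \<open>Positivity near circular orbits of small angular momentum\<close>

lemma open_orbit_region: "open orbit_region"
  unfolding orbit_region_def
  by (intro open_Collect_conj open_Collect_less continuous_intros)

text \<open>In u the potential starts at 0 for u = 0, that is r at infinity, and increases up to the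
  barrier \<open>w\<close>. Hence negative energies lie below the barrier.\<close>

lemma W_r2_pos:
  assumes "\<epsilon> > 0" "\<sigma> > 0" "0 < red_level \<epsilon> \<sigma> L" "red_level \<epsilon> \<sigma> L < 2/5"
  shows "W \<epsilon> \<sigma> L (r2 \<epsilon> \<sigma> L) > 0"
proof -
  let ?\<alpha> = "red_level \<epsilon> \<sigma> L"
  obtain w where w: "0 < w" "\<And>u. 0 < u \<Longrightarrow> u < w \<Longrightarrow> crit_level u < ?\<alpha>" "r2 \<epsilon> \<sigma> L = \<sigma> / sqrt w"
    using crit_eq[OF assms] by metis
  have "red_pot ?\<alpha> 0 < red_pot ?\<alpha> w"
  proof (rule DERIV_pos_imp_increasing_open[OF w(1)])
    fix x assume "0 < x" "x < w"
    then show "\<exists>y. (red_pot ?\<alpha> has_real_derivative y) (at x) \<and> 0 < y"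
      using red_pot_deriv[of ?\<alpha> x] w(2)[of x] by (intro exI[of _ "?\<alpha> - crit_level x"]) auto
  next
    show "continuous_on {0..w} (red_pot ?\<alpha>)"
      unfolding red_pot_def[abs_def] by (intro continuous_intros)
  qed
  then show ?thesis
    using W_at_sqrt[OF assms(1,2) w(1)] assms(1) by (simp add: w(3)) (simp add: red_pot_def)
qed

lemma minus_w0_eq:
  assumes "\<epsilon> > 0" "\<sigma> > 0" "0 < red_level \<epsilon> \<sigma> L" "red_level \<epsilon> \<sigma> L < 2/5"
  shows "- w0 \<epsilon> \<sigma> L = 4 * \<epsilon> * en (min_root (red_level \<epsilon> \<sigma> L)) 0"
proof -
  let ?v = "min_root (red_level \<epsilon> \<sigma> L)"
  have v: "3/5 < ?v" "crit_level ?v = red_level \<epsilon> \<sigma> L"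
    using crit_level_roots[OF assms(3,4)] by blast+
  have "r0 \<epsilon> \<sigma> L = \<sigma> / sqrt ?v" using crit_eq[OF assms] by metis
  then show ?thesis
    using W_at_sqrt[OF assms(1,2), of ?v L] v by (simp add: w0_def en_0 ang_0)
qed

text \<open>Positivity of \<open>red_det\<close> at (M, 0) spreads to a neighbourhood by continuity.
  For small level, the circular orbit and the orbits of slightly higher energy all have coordinates
  in it.\<close>

lemma small_level_det_pos:
  assumes "\<epsilon> > 0" "\<sigma> > 0"
  obtains \<delta> where "\<delta> > 0"
    "\<And>L. L > 0 \<Longrightarrow> red_level \<epsilon> \<sigma> L < \<delta> \<Longrightarrow>
      (\<exists>l>0. ((\<lambda>H. \<D> \<epsilon> \<sigma> H L) \<longlongrightarrow> l) (at_right (- w0 \<epsilon> \<sigma> L)))"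
    "\<And>L. L > 0 \<Longrightarrow> red_level \<epsilon> \<sigma> L < \<delta> \<Longrightarrow>
      (\<exists>H' > - w0 \<epsilon> \<sigma> L. \<forall>H. - w0 \<epsilon> \<sigma> L < H \<and> H < H' \<longrightarrow>
        H < W \<epsilon> \<sigma> L (r2 \<epsilon> \<sigma> L) \<and> \<D> \<epsilon> \<sigma> H L > 0)"
proof -
  define M where "M = root 3 (1/2)"
  have M: "M > 0" "M^3 = 1/2" by (auto simp: M_def)
  have M_bounds: "78/100 < M" "M < 81/100"
    using power_mono[of M "78/100" 3] power_mono[of "81/100" M 3] M
    by (auto simp: power_divide not_le[symmetric])
  have ev: "ang M 0 = 0" "en M 0 = - 1/4" "ang_m M 0 < 0"
  proof -
    have "M^5 = M^2 * M^3" "M^4 = M * M^3" "M^6 = M^3 * M^3" by (simp_all add: power_numeral_reduce)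
    then have p: "M^5 = M^2 * (1/2)" "M^4 = M * (1/2)" "M^6 = 1/2 * (1/2)"
      unfolding M(2) .
    then show "ang M 0 = 0" "en M 0 = - 1/4" "ang_m M 0 < 0"
      using M(1) by (simp_all add: ang_def en_def ang_m_def M(2) p)
  qed
  define S where "S = {78/100<..<81/100} \<times> {0..<1/100} \<inter> {x. jac (fst x) (snd x) < (0::real)}"
  \<comment> \<open>Since \<open>S\<close> contains its edge s = 0, the positivity set is open only
    relative to \<open>S\<close>; \<open>Q\<close> is an open subset of the plane that cuts it
    out.\<close>
  obtain Q where Q: "open Q" "S \<inter> (\<lambda>x. red_det (fst x) (snd x)) -` {0<..} = S \<inter> Q"
    using continuous_openin_preimage_gen[OF continuous_on_red_det open_greaterThan[of 0]]
    unfolding openin_open S_def by blast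
  have MS: "(M, 0) \<in> S" "(M, 0) \<in> orbit_region"
    using M_bounds red_det_pos(2)[OF M M_bounds] ev by (auto simp: S_def orbit_region_def)
  then have "(M, 0) \<in> orbit_region \<inter> Q"
    using Q(2) red_det_pos(1)[OF M M_bounds] by auto
  then obtain U Y g where U: "open U" "U \<subseteq> orbit_region \<inter> Q" "(M, 0) \<in> U"
    and Y: "open Y" "coords (M, 0) \<in> Y" "homeomorphism U Y coords g"
    and g: "\<And>y. y \<in> Y \<Longrightarrow> jac (fst (g y)) (snd (g y)) \<noteq> 0 \<Longrightarrow>
      (g has_derivative coords_inv_D (g y)) (at y)"
    using coords_local_inverse[of "orbit_region \<inter> Q" "(M, 0)"] Q(1) open_orbit_region
      red_det_pos(2)[OF M M_bounds] by (metis fst_conv snd_conv less_irrefl open_Int)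
  have gU: "g y \<in> U" "coords (g y) = y" if "y \<in> Y" for y
    using Y(3) that by (auto simp: homeomorphism_def)
  have g_orb: "g y \<in> orbit_region" if "y \<in> Y" for y
    using gU[OF that] U(2) by auto
  have g': "(g has_derivative coords_inv_D (g y)) (at y)" if "y \<in> Y" for y
    using g[OF that] g_orb[OF that] by (auto simp: orbit_region_def)
  have in_S: "x \<in> S" "red_det (fst x) (snd x) > 0" if "x \<in> U" "snd x \<ge> 0" for x
  proof -
    show "x \<in> S" using that U(2) by (cases x) (auto simp: S_def orbit_region_def)
    then show "red_det (fst x) (snd x) > 0" using Q(2) that U(2) by blast
  qed
  obtain A B where AB: "open A" "open B" "0 \<in> A" "- 1/4 \<in> B" "A \<times> B \<subseteq> Y"
    using open_prod_elim[OF Y(1,2)] ev unfolding coords_def fst_conv snd_conv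
    by (metis mem_Sigma_iff)
  obtain e1 where e1: "e1 > 0" "ball 0 e1 \<subseteq> A" using AB openE by blast
  obtain e2 where e2: "e2 > 0" "ball (- 1/4) e2 \<subseteq> B" using AB openE by blast
  \<comment> \<open>The cap 1/4 keeps the energies below -1/4 + e at most 0, hence under the
    barrier.\<close>
  define e where "e = min e2 (1/4)"
  have e: "e > 0" "e \<le> 1/4" using e2 by (auto simp: e_def)
  have inY: "(a, h) \<in> Y" if "0 < a" "a < e1" "- 1/4 - e < h" "h < - 1/4 + e" for a h
  proof -
    have "a \<in> A" using that e1 by (intro subsetD[OF e1(2)]) (auto simp: dist_real_def)
    moreover have "h \<in> B" using that by (intro subsetD[OF e2(2)]) (auto simp: dist_real_def e_def)
    ultimately show ?thesis using AB(5) by blast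
  qed
  \<comment> \<open>Those \<open>m\<close> whose circular orbit (m, 0) lies in \<open>U\<close> and
    has its energy in the chosen window.\<close>
  define N where "N = {m. (m, 0) \<in> U} \<inter> {m. - 1/4 - e < en m 0} \<inter> {m. en m 0 < - 1/4 + e}"
  have "open {m. (m, 0) \<in> U}"
  proof -
    have "continuous_on UNIV (\<lambda>m. (m, 0::real))" by (intro continuous_intros)
    from open_vimage[OF U(1) this] show ?thesis by (simp add: vimage_def)
  qed
  then have "open N"
    unfolding N_def by (intro open_Int open_Collect_less continuous_intros)
  moreover have "M \<in> N" using U(3) ev e by (simp add: N_def)
  ultimately obtain \<eta> where \<eta>: "\<eta> > 0" "ball M \<eta> \<subseteq> N" using openE by blast
  define m1 where "m1 = M - \<eta> / 2"
  have N: "m \<in> N" if "m1 \<le> m" "m \<le> M" for m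
    using that \<eta> by (intro subsetD[OF \<eta>(2)]) (auto simp: m1_def dist_real_def)
  have m1: "m1 < M" "78/100 < m1"
    using N[of m1] U(2) \<eta>(1) by (auto simp: m1_def N_def orbit_region_def)
  have crit_M: "crit_level M = 0" using ev by (simp add: ang_0)
  have crit_m1: "crit_level m1 > 0"
    using crit_level_strict_antimono[of m1 M] m1 crit_M by simp
  \<comment> \<open>The first bound places \<open>min_root \<alpha>\<close> between
    \<open>m1\<close> and \<open>M\<close>, the second places \<alpha> in the box inside
    \<open>Y\<close>, and the third gives the two critical points.\<close>
  define \<delta> where "\<delta> = min (crit_level m1) (min e1 (2/5))"
  have main: "(\<exists>l>0. ((\<lambda>H. \<D> \<epsilon> \<sigma> H L) \<longlongrightarrow> l) (at_right (- w0 \<epsilon> \<sigma> L))) \<and>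
      (\<exists>H' > - w0 \<epsilon> \<sigma> L. \<forall>H. - w0 \<epsilon> \<sigma> L < H \<and> H < H' \<longrightarrow>
        H < W \<epsilon> \<sigma> L (r2 \<epsilon> \<sigma> L) \<and> \<D> \<epsilon> \<sigma> H L > 0)"
    if L: "L > 0" "red_level \<epsilon> \<sigma> L < \<delta>" for L
  proof -
    define \<alpha> where "\<alpha> = red_level \<epsilon> \<sigma> L"
    define m0 where "m0 = min_root \<alpha>"
    define h0 where "h0 = en m0 0"
    have \<alpha>: "0 < \<alpha>" "\<alpha> < crit_level m1" "\<alpha> < e1" "\<alpha> < 2/5"
      using red_level_pos[OF assms L(1)] L(2) by (auto simp: \<alpha>_def \<delta>_def)
    have m0: "3/5 < m0" "crit_level m0 = \<alpha>"
      unfolding m0_def using crit_level_roots[OF \<alpha>(1,4)] by blast+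
    have "m1 < m0"
      using crit_level_strict_antimono[of m0 m1] m0 \<alpha> by (cases m0 m1 rule: linorder_cases) auto
    moreover have "m0 < M"
      using crit_level_strict_antimono[of M m0] M_bounds crit_M m0 \<alpha>
      by (cases m0 M rule: linorder_cases) auto
    ultimately have m0N: "m0 \<in> N" using N by auto
    then have h0: "- 1/4 - e < h0" "h0 < - 1/4 + e" by (auto simp: N_def h0_def)
    have w0: "- w0 \<epsilon> \<sigma> L = 4 * \<epsilon> * h0"
      using minus_w0_eq[OF assms, of L] \<alpha> by (simp add: \<alpha>_def m0_def h0_def)
    have "coords (m0, 0) = (\<alpha>, h0)" by (simp add: coords_def ang_0 m0 h0_def)
    moreover have "(m0, 0) \<in> U" using m0N by (simp add: N_def)
    ultimately have gh0: "g (\<alpha>, h0) = (m0, 0)"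
      using Y(3) by (metis homeomorphism_apply1)
    have hY: "(\<alpha>, h) \<in> Y" if "h0 \<le> h" "h < - 1/4 + e" for h
      using inY[of \<alpha> h] \<alpha> h0 that by auto
    \<comment> \<open>At fixed level, ds/dh = \<open>ang_m / jac\<close> is a quotient of two
      negative numbers, and s = 0 at the circular energy \<open>h0\<close>.\<close>
    have s_pos: "snd (g (\<alpha>, h)) > 0" if h: "h0 < h" "h < - 1/4 + e" for h
    proof -
      have "snd (g (\<alpha>, h0)) < snd (g (\<alpha>, h))"
      proof (rule DERIV_pos_imp_increasing[OF h(1)])
        fix x assume "h0 \<le> x" "x \<le> h"
        then have xY: "(\<alpha>, x) \<in> Y" using hY h by auto
        let ?m = "fst (g (\<alpha>, x))" and ?s = "snd (g (\<alpha>, x))"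
        have "((\<lambda>x. (\<alpha>, x)) has_derivative (\<lambda>x. (0, x))) (at x)"
          by (auto intro!: derivative_eq_intros)
        from has_derivative_snd[OF has_derivative_compose[OF this g'[OF xY]]]
        have "((\<lambda>x. snd (g (\<alpha>, x))) has_real_derivative ang_m ?m ?s / jac ?m ?s) (at x)"
          by (rule has_derivative_imp_has_field_derivative) (simp add: coords_inv_D_def)
        moreover have "ang_m ?m ?s / jac ?m ?s > 0"
          using g_orb[OF xY] by (simp add: orbit_region_def divide_neg_neg)
        ultimately show "\<exists>y. ((\<lambda>x. snd (g (\<alpha>, x))) has_real_derivative y) (at x) \<and> 0 < y"
          by blast
      qed
      then show ?thesis by (simp add: gh0)
    qed
    \<comment> \<open>Unlike \<open>\<D>\<close>, this expression remains continuous at the end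
      point H = 4 \<epsilon> \<open>h0\<close>, that is at \<open>- w0\<close>; its value there is
      the limit.\<close>
    define R where "R H = red_det (fst (g (\<alpha>, H / (4 * \<epsilon>)))) (snd (g (\<alpha>, H / (4 * \<epsilon>)))) / (32 * \<epsilon>^2)" for H
    have D: "\<D> \<epsilon> \<sigma> H L = R H" "R H > 0" if H: "4 * \<epsilon> * h0 < H" "H < 4 * \<epsilon> * (- 1/4 + e)" for H
    proof -
      have h: "h0 < H / (4 * \<epsilon>)" "H / (4 * \<epsilon>) < - 1/4 + e"
        using H assms(1) by (simp_all add: pos_less_divide_eq pos_divide_less_eq mult.commute)
      have "(red_level \<epsilon> \<sigma> L, H / (4 * \<epsilon>)) \<in> Y" using hY h by (simp add: \<alpha>_def)
      from D_formula[OF assms L(1) Y(1,3) _ g' this surjective_pairing] s_pos[OF h] U(2)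
      show "\<D> \<epsilon> \<sigma> H L = R H" by (auto simp: R_def \<alpha>_def)
      have "g (\<alpha>, H / (4 * \<epsilon>)) \<in> U" using gU hY h by auto
      then show "R H > 0" using in_S(2) s_pos[OF h] assms(1) by (simp add: R_def)
    qed
    \<comment> \<open>The midpoint of the energy window, so that the closed interval from the
      circular energy to \<open>H1\<close> stays strictly below the upper end.\<close>
    define H1 where "H1 = 4 * \<epsilon> * ((h0 + (- 1/4 + e)) / 2)"
    have H1: "4 * \<epsilon> * h0 < H1" "H1 < 4 * \<epsilon> * (- 1/4 + e)"
      unfolding H1_def using h0 assms(1) by (auto intro!: mult_strict_left_mono)
    have R_cont: "continuous_on {4 * \<epsilon> * h0..H1} R"
    proof -
      have sub: "(\<alpha>, H / (4 * \<epsilon>)) \<in> Y \<and> g (\<alpha>, H / (4 * \<epsilon>)) \<in> S" if H: "H \<in> {4 * \<epsilon> * h0..H1}" for H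
      proof -
        have h: "h0 \<le> H / (4 * \<epsilon>)" "H / (4 * \<epsilon>) < - 1/4 + e"
          using H H1 assms(1) by (auto simp: pos_le_divide_eq pos_divide_less_eq mult.commute)
        then have "snd (g (\<alpha>, H / (4 * \<epsilon>))) \<ge> 0"
          using s_pos[of "H / (4 * \<epsilon>)"] gh0 by (cases "H / (4 * \<epsilon>) = h0") auto
        then show ?thesis using in_S(1) gU(1) hY[OF h] by auto
      qed
      have "continuous_on {4 * \<epsilon> * h0..H1} (\<lambda>H. g (\<alpha>, H / (4 * \<epsilon>)))"
        by (rule continuous_on_compose2[OF homeomorphism_cont2[OF Y(3)]])
          (use sub assms(1) in \<open>auto intro!: continuous_intros\<close>)
      then have "continuous_on {4 * \<epsilon> * h0..H1}
          (\<lambda>H. red_det (fst (g (\<alpha>, H / (4 * \<epsilon>)))) (snd (g (\<alpha>, H / (4 * \<epsilon>)))))"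
        by (rule continuous_on_compose2[OF continuous_on_red_det[folded S_def]]) (use sub in auto)
      then show ?thesis unfolding R_def using assms(1) by (intro continuous_on_divide continuous_on_const) auto
    qed
    have "(R \<longlongrightarrow> R (4 * \<epsilon> * h0)) (at_right (4 * \<epsilon> * h0))"
      using continuous_on_Icc_at_rightD[OF R_cont H1(1)] .
    moreover have "eventually (\<lambda>H. R H = \<D> \<epsilon> \<sigma> H L) (at_right (4 * \<epsilon> * h0))"
      using D(1) H1 unfolding eventually_at_right_field by (metis less_trans)
    ultimately have "((\<lambda>H. \<D> \<epsilon> \<sigma> H L) \<longlongrightarrow> R (4 * \<epsilon> * h0)) (at_right (4 * \<epsilon> * h0))"
      by (rule Lim_transform_eventually)
    moreover have "R (4 * \<epsilon> * h0) > 0"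
      using in_S(2)[of "(m0, 0)"] m0N assms(1) gh0 by (simp add: R_def N_def)
    moreover have "H < W \<epsilon> \<sigma> L (r2 \<epsilon> \<sigma> L)" if "H < H1" for H
    proof -
      have "4 * \<epsilon> * (- 1/4 + e) \<le> 0" using e assms(1) by (intro mult_nonneg_nonpos) auto
      then show ?thesis
        using W_r2_pos[OF assms, of L] \<alpha> H1 that by (simp add: \<alpha>_def)
    qed
    moreover have "\<D> \<epsilon> \<sigma> H L > 0" if "4 * \<epsilon> * h0 < H" "H < H1" for H
      using D[of H] that H1 by auto
    ultimately show ?thesis using w0 H1(1) by metis
  qed
  have "\<delta> > 0" using crit_m1 e1 by (simp add: \<delta>_def)
  then show ?thesis using that main by blast
qed

theorem mainTheorem6:
  fixes \<epsilon> \<sigma> :: real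
  assumes "\<epsilon> > 0" and "\<sigma> > 0"
  shows "(\<exists>L1>0. \<forall>L. admissible \<epsilon> \<sigma> L \<and> L < L1 \<longrightarrow>
            (\<exists>l>0. ((\<lambda>H. \<D> \<epsilon> \<sigma> H L) \<longlongrightarrow> l) (at_right (- w0 \<epsilon> \<sigma> L))))
       \<and> (\<exists>L2>0. \<forall>L. admissible \<epsilon> \<sigma> L \<and> L < L2 \<longrightarrow>
            (\<exists>H'. H' > - w0 \<epsilon> \<sigma> L \<and>
               (\<forall>H. - w0 \<epsilon> \<sigma> L < H \<and> H < H' \<longrightarrow>
                  (H, L) \<in> Lam \<epsilon> \<sigma> \<and> \<D> \<epsilon> \<sigma> H L > 0)))"
proof -
  obtain \<delta> where \<delta>: "\<delta> > 0"
    "\<And>L. L > 0 \<Longrightarrow> red_level \<epsilon> \<sigma> L < \<delta> \<Longrightarrow>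
      (\<exists>l>0. ((\<lambda>H. \<D> \<epsilon> \<sigma> H L) \<longlongrightarrow> l) (at_right (- w0 \<epsilon> \<sigma> L)))"
    "\<And>L. L > 0 \<Longrightarrow> red_level \<epsilon> \<sigma> L < \<delta> \<Longrightarrow>
      (\<exists>H' > - w0 \<epsilon> \<sigma> L. \<forall>H. - w0 \<epsilon> \<sigma> L < H \<and> H < H' \<longrightarrow>
        H < W \<epsilon> \<sigma> L (r2 \<epsilon> \<sigma> L) \<and> \<D> \<epsilon> \<sigma> H L > 0)"
    using small_level_det_pos[OF assms] by metis
  \<comment> \<open>The angular momentum whose level is exactly \<delta>.\<close>
  define L0 where "L0 = sqrt (8 * \<epsilon> * \<sigma>^2 * \<delta>)"
  have L0: "L0 > 0" using assms \<delta>(1) by (simp add: L0_def)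
  have level: "L > 0 \<and> red_level \<epsilon> \<sigma> L < \<delta>" if "admissible \<epsilon> \<sigma> L \<and> L < L0" for L
  proof -
    have L: "L > 0" using that by (simp add: admissible_def)
    have "L^2 < L0^2" using that L by (intro power_strict_mono) auto
    also have "L0^2 = 8 * \<epsilon> * \<sigma>^2 * \<delta>" using assms \<delta>(1) by (simp add: L0_def)
    finally have "red_level \<epsilon> \<sigma> L < \<delta>"
      unfolding red_level_def using assms by (simp add: divide_less_eq mult.commute)
    then show ?thesis using L by simp
  qed
  show ?thesis
  proof (rule conjI; rule exI[of _ L0]; intro conjI allI impI L0)
    fix L assume L: "admissible \<epsilon> \<sigma> L \<and> L < L0"
    show "\<exists>l>0. ((\<lambda>H. \<D> \<epsilon> \<sigma> H L) \<longlongrightarrow> l) (at_right (- w0 \<epsilon> \<sigma> L))"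
      using \<delta>(2) level[OF L] by blast
    show "\<exists>H'. H' > - w0 \<epsilon> \<sigma> L \<and> (\<forall>H. - w0 \<epsilon> \<sigma> L < H \<and> H < H' \<longrightarrow>
        (H, L) \<in> Lam \<epsilon> \<sigma> \<and> \<D> \<epsilon> \<sigma> H L > 0)"
      using \<delta>(3)[of L] level[OF L] L unfolding Lam_def by auto
  qed
qed

end
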